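(* Let $B$ be a Blaschke product of degree three whose two critical points $z_1,z_2$ in $\mathbb{D}$ are distinct, and set $k_1=B(z_1)$, $k_2=B(z_2)$. Let $$c=-3\left(\frac{k_2-k_1}{4}\right)^{2/3},\qquad d=\frac{k_1+k_2}{2},$$ where $\left(\frac{k_2-k_1}{4}\right)^{2/3}$ means $r^2$ for an arbitrarily chosen complex cube root $r$ of $\frac{k_2-k_1}{4}$, and let $p(z)=z^3+cz+d$. Then: (i) $p$ has critical values $k_1$ and $k_2$, and $p$ on $\mathbb{D}_p$ is a conformal model for $B$ on $\mathbb{D}$; that is, there is an analytic bijection $\varphi:\mathbb{D}\to\mathbb{D}_p$ with $B=p\circ\varphi$ on $\mathbb{D}$. (ii) Any such $\varphi$ is given by the cubic formula: for every $z\in\mathbb{D}$ there are complex numbers $S,U,V$ such that $$S^2=\frac{(d-B(z))^2}{4}+\frac{c^3}{27},\quad U^3=-\frac{d-B(z)}{2}+S,\quad V^3=-\frac{d-B(z)}{2}-S,\quad UV=-\frac{c}{3},$$ and $\varphi(z)=U+V$. (iii) There is at most one analytic function $\varphi:\mathbb{D}\to\mathbb{C}$ satisfying $\varphi^3+c\varphi+(d-B)=0$ on $\mathbb{D}$.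
   Context: $\mathbb{D}$ is the open unit disk in $\mathbb{C}$. A (finite) Blaschke product of degree $n\ge 1$ is a rational function $B(z)=\lambda\prod_{j=1}^n\frac{z-a_j}{1-\overline{a_j}z}$ with $|\lambda|=1$ and $a_1,\dots,a_n\in\mathbb{D}$ (not necessarily distinct). A Blaschke product of degree $n$ has exactly $n-1$ critical points in $\mathbb{D}$, counted with multiplicity. A critical value of a function is its value at a critical point. For a polynomial $p\in\mathbb{C}[z]$, $\mathbb{D}_p=\{z\in\mathbb{C}:|p(z)|<1\}$. For domains (connected open sets) $D,E\subset\mathbb{C}$ and analytic functions $f:D\to\mathbb{C}$, $g:E\to\mathbb{C}$, $g$ on $E$ is a conformal model for $f$ on $D$ if there is an analytic bijection $\varphi:D\to E$ such that $f=g\circ\varphi$ on $D$; in particular, the assertion that $p$ on $\mathbb{D}_p$ is a conformal model includes that $\mathbb{D}_p$ is connected. *)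

theory Defs
  imports "HOL-Analysis.Analysis" "HOL-Computational_Algebra.Polynomial"
begin

abbreviation unit_disk :: "complex set" where
  "unit_disk \<equiv> ball 0 1"

text \<open>
  The poles lie outside the closed disk, so the convention \<open>x / 0 = 0\<close> does not affect
  the values on the unit disk.
\<close>

definition blaschke_product :: "nat \<Rightarrow> (complex \<Rightarrow> complex) \<Rightarrow> bool" where
  "blaschke_product n B \<longleftrightarrow> n \<ge> 1 \<and>
     (\<exists>l a. norm l = 1 \<and> (\<forall>j\<in>{1..n}. a j \<in> unit_disk) \<and>
        B = (\<lambda>z. l * (\<Prod>j=1..n. (z - a j) / (1 - cnj (a j) * z))))"

definition critical_points :: "(complex \<Rightarrow> complex) \<Rightarrow> complex set \<Rightarrow> complex set" where
  "critical_points f D = {z \<in> D. deriv f z = 0}"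

definition critical_values :: "(complex \<Rightarrow> complex) \<Rightarrow> complex set \<Rightarrow> complex set" where
  "critical_values f D = f ` critical_points f D"

definition poly_disk :: "complex poly \<Rightarrow> complex set" where
  "poly_disk p = {z. norm (poly p z) < 1}"

text \<open>
  \<open>conformal_equivalence \<phi> f D g E\<close>: the map \<open>\<phi>\<close> from \<open>D\<close> to \<open>E\<close>
  witnesses that \<open>g\<close> on \<open>E\<close> is a conformal model for \<open>f\<close> on \<open>D\<close>.
\<close>

definition conformal_equivalence ::
  "(complex \<Rightarrow> complex) \<Rightarrow> (complex \<Rightarrow> complex) \<Rightarrow> complex set \<Rightarrow> (complex \<Rightarrow> complex) \<Rightarrow> complex set \<Rightarrow> bool"
where
  "conformal_equivalence \<phi> f D g E \<longleftrightarrow>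
     \<phi> analytic_on D \<and> bij_betw \<phi> D E \<and> (\<forall>z\<in>D. f z = g (\<phi> z))"

definition conformal_model ::
  "(complex \<Rightarrow> complex) \<Rightarrow> complex set \<Rightarrow> (complex \<Rightarrow> complex) \<Rightarrow> complex set \<Rightarrow> bool"
where
  "conformal_model g E f D \<longleftrightarrow>
     open D \<and> connected D \<and> open E \<and> connected E \<and>
     f analytic_on D \<and> g analytic_on E \<and>
     (\<exists>\<phi>. conformal_equivalence \<phi> f D g E)"

end

theory Submission
  imports Defs "HOL-Complex_Analysis.Complex_Analysis"
    "HOL-Computational_Algebra.Fundamental_Theorem_Algebra"
begin

text \<open>
  Put \<open>F = (B - d) / (2 r\<^sup>3)\<close> and \<open>\<phi> = 2 r G\<close>. The equation \<open>p \<circ> \<phi> = B\<close> then reads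
  \<open>4 G\<^sup>3 - 3 G = F\<close>, with the third Chebyshev polynomial on the left. Since \<open>B - k\<^sub>1\<close> and \<open>B - k\<^sub>2\<close>
  have three zeros in the disk, two of which coincide at \<open>z\<^sub>1\<close> and \<open>z\<^sub>2\<close>, we have
  \<open>F\<^sup>2 - 1 = (z - a) (z - b) K\<^sup>2\<close> with \<open>a\<close> and \<open>b\<close> the remaining simple zeros. Substituting
  \<open>z = m + h cos u\<close> with \<open>a, b = m \<mp> h\<close> uniformizes the square root, so that \<open>F = cosh L\<close> with an odd
  function \<open>L\<close> of \<open>u\<close>; the relevant domain in the \<open>u\<close>-plane is contractible. As \<open>B\<close> winds three times
  around the circle, \<open>L (u + 2 \<pi>) = L u \<plusminus> 6 \<pi> \<i>\<close>, hence \<open>cosh (L / 3)\<close> is even and periodic and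
  descends to the required function \<open>G\<close> of \<open>z\<close>.

  Any solution \<open>\<phi>\<close> is bijective onto the set \<open>\<bar>p\<bar> < 1\<close>. Its image is open and closed there, and a nonempty
  open and closed part is everything, because \<open>p\<close> maps it onto the disk and the preimages
  \<open>r\<close> and \<open>- 2 r\<close> of \<open>k\<^sub>1\<close> are joined by a segment in \<open>\<bar>p\<bar> < 1\<close>. Counting the preimages of a generic point
  under \<open>p\<close> and under \<open>B\<close> gives injectivity. It follows that \<open>\<phi>\<close> takes the value \<open>r\<close> at \<open>z\<^sub>1\<close>, so two
  solutions take the value \<open>- 2 r\<close> at the same point; they agree near it since \<open>- 2 r\<close> is a
  simple preimage of \<open>k\<^sub>1\<close>, and then everywhere.
\<close>

section \<open>Geometry of the cosine: preimages of convex sets\<close>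

text \<open>On a vertical line the real and imaginary parts of \<open>cos\<close> both solve f'' = f
  in the height, so the values at heights \<open>0\<close> and \<open>y\<close> determine those in
  between, with hyperbolic sine weights. Since \<open>cosh\<close> is at least 1, the addition
  theorem bounds the sum of the weights by 1, which places the value in the triangle spanned by the
  two end values and 0.\<close>

lemma cos_vertical_interpolation:
  fixes x y t :: real
  assumes "0 \<le> t" "t \<le> 1"
  obtains \<gamma> \<delta> :: real where "0 \<le> \<gamma>" "0 \<le> \<delta>" "\<gamma> + \<delta> \<le> 1"
    "cos (Complex x (t * y)) = \<gamma> *\<^sub>R cos (Complex x y) + \<delta> *\<^sub>R cos (complex_of_real x)"
proof (cases "y = 0")
  case True
  show ?thesis by (rule that[of 1 0]) (auto simp: True)
next
  case False
  define \<gamma> where "\<gamma> = sinh (t * \<bar>y\<bar>) / sinh \<bar>y\<bar>"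
  define \<delta> where "\<delta> = sinh ((1 - t) * \<bar>y\<bar>) / sinh \<bar>y\<bar>"
  have pos: "sinh \<bar>y\<bar> > 0" using False by simp
  have nonneg: "0 \<le> t * \<bar>y\<bar>" "0 \<le> (1 - t) * \<bar>y\<bar>" using assms by auto
  have split: "t * \<bar>y\<bar> + (1 - t) * \<bar>y\<bar> = \<bar>y\<bar>" by (simp add: algebra_simps)
  have "sinh (t * \<bar>y\<bar>) * 1 + 1 * sinh ((1 - t) * \<bar>y\<bar>)
      \<le> sinh (t * \<bar>y\<bar>) * cosh ((1 - t) * \<bar>y\<bar>) + cosh (t * \<bar>y\<bar>) * sinh ((1 - t) * \<bar>y\<bar>)"
    using nonneg by (intro add_mono mult_mono cosh_real_ge_1) auto
  also have "\<dots> = sinh \<bar>y\<bar>"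
    by (subst sinh_add[symmetric]) (simp only: split)
  finally have sum: "\<gamma> + \<delta> \<le> 1"
    using pos by (simp add: \<gamma>_def \<delta>_def field_simps)
  \<comment> \<open>A quotient of functions odd in \<open>y\<close> does not see the absolute value.
    The form with \<open>\<bar>y\<bar>\<close> gives the inequalities, the signed form the
    identities.\<close>
  have abs_odd: "sinh (u * \<bar>y\<bar>) / sinh \<bar>y\<bar> = sinh (u * y) / sinh y" for u :: real
    by (cases "y \<ge> 0") auto
  have sinh_y: "sinh y \<noteq> 0" using False by simp
  have cosh_eq: "cosh (t * y) = \<gamma> * cosh y + \<delta>"
  proof -
    have "sinh ((1 - t) * y) = sinh (y - t * y)" by (simp add: algebra_simps)
    also have "\<dots> = sinh y * cosh (t * y) - cosh y * sinh (t * y)" by (rule sinh_diff)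
    finally show ?thesis
      using sinh_y unfolding \<gamma>_def \<delta>_def abs_odd by (simp add: field_simps)
  qed
  have sinh_eq: "sinh (t * y) = \<gamma> * sinh y"
    using sinh_y unfolding \<gamma>_def abs_odd by simp
  have cos_Complex: "cos (Complex x v) = Complex (cos x * cosh v) (- (sin x * sinh v))" for v
    by (simp add: complex_eq_iff Re_cos Im_cos cosh_field_def sinh_field_def field_simps)
  show ?thesis
  proof (rule that[of \<gamma> \<delta>])
    show "0 \<le> \<gamma>" "0 \<le> \<delta>" using nonneg pos by (auto simp: \<gamma>_def \<delta>_def)
    show "cos (Complex x (t * y)) = \<gamma> *\<^sub>R cos (Complex x y) + \<delta> *\<^sub>R cos (complex_of_real x)"
      by (simp add: cos_Complex complex_eq_iff cosh_eq sinh_eq algebra_simps cos_of_real)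
  qed (rule sum)
qed

text \<open>The set is pushed vertically onto the real axis, and the axis is then shrunk to 0. Real
  points map into the segment from \<open>m - h\<close> to \<open>m + h\<close>. The vertical
  segment from \<open>u\<close> to \<open>Re u\<close> maps into the triangle spanned by the images
  of its ends and the midpoint \<open>m\<close>, which stands for the cosine value 0 and receives
  the leftover weight. Convexity of \<open>S\<close> covers both.\<close>

lemma contractible_cos_preimage:
  fixes m h :: complex
  assumes "convex S" "m + h \<in> S" "m - h \<in> S"
  shows "contractible {u. m + h * cos u \<in> S}" (is "contractible ?U")
proof -
  have "m = (1/2) *\<^sub>R (m + h) + (1/2) *\<^sub>R (m - h)" by (simp add: scaleR_conv_of_real field_simps)
  then have m: "m \<in> S"
    using convexD[OF assms(1,2,3), of "1/2" "1/2"] by simp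
  have real: "complex_of_real x \<in> ?U" for x :: real
  proof -
    have "0 \<le> 1 + cos x" using cos_ge_minus_one[of x] by linarith
    have "((1 + cos x) / 2) *\<^sub>R (m + h) + ((1 - cos x) / 2) *\<^sub>R (m - h) \<in> S"
      using \<open>0 \<le> 1 + cos x\<close> by (intro convexD[OF assms]) (auto simp: field_simps)
    also have "((1 + cos x) / 2) *\<^sub>R (m + h) + ((1 - cos x) / 2) *\<^sub>R (m - h) = m + h * cos (of_real x)"
      by (simp add: scaleR_conv_of_real field_simps cos_of_real)
    finally show ?thesis by simp
  qed
  have "homotopic_with_canon (\<lambda>_. True) ?U ?U (\<lambda>u. of_real (Re u)) id"
  proof (rule homotopic_with_linear)
    fix u assume u: "u \<in> ?U"
    show "closed_segment (of_real (Re u)) (id u) \<subseteq> ?U"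
    proof
      fix v assume "v \<in> closed_segment (of_real (Re u)) (id u)"
      then obtain t where t: "0 \<le> t" "t \<le> 1" "v = (1 - t) *\<^sub>R of_real (Re u) + t *\<^sub>R u"
        by (auto simp: closed_segment_def)
      have v: "v = Complex (Re u) (t * Im u)"
        using t by (auto simp: complex_eq_iff algebra_simps)
      obtain \<gamma> \<delta> :: real where gd: "0 \<le> \<gamma>" "0 \<le> \<delta>" "\<gamma> + \<delta> \<le> 1"
        "cos v = \<gamma> *\<^sub>R cos u + \<delta> *\<^sub>R cos (complex_of_real (Re u))"
        using cos_vertical_interpolation[OF t(1,2), of "Re u" "Im u"] unfolding v complex_surj by blast
      have 1: "m + h * cos u \<in> S" "m + h * cos (complex_of_real (Re u)) \<in> S"
        using u real[of "Re u"] by auto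
      have "\<gamma> *\<^sub>R (m + h * cos u) + \<delta> *\<^sub>R (m + h * cos (complex_of_real (Re u)))
          + (1 - \<gamma> - \<delta>) *\<^sub>R m \<in> S"
      proof (cases "\<gamma> + \<delta> = 0")
        case True
        then have "\<gamma> = 0" "\<delta> = 0" using gd by auto
        then show ?thesis using m by simp
      next
        case False
        define s where "s = \<gamma> + \<delta>"
        have s: "s > 0" "s \<le> 1" using False gd by (auto simp: s_def)
        have "(\<gamma> / s) *\<^sub>R (m + h * cos u) + (\<delta> / s) *\<^sub>R (m + h * cos (complex_of_real (Re u))) \<in> S"
          using gd s by (intro convexD[OF assms(1) 1]) (auto simp: s_def add_divide_distrib[symmetric])
        from convexD[OF assms(1) this m, of s "1 - s"] s
        have "\<gamma> *\<^sub>R (m + h * cos u) + \<delta> *\<^sub>R (m + h * cos (complex_of_real (Re u))) + (1 - s) *\<^sub>R m \<in> S"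
          by (simp add: scaleR_add_right)
        then show ?thesis by (simp add: s_def diff_diff_eq)
      qed
      also have "\<gamma> *\<^sub>R (m + h * cos u) + \<delta> *\<^sub>R (m + h * cos (complex_of_real (Re u)))
          + (1 - \<gamma> - \<delta>) *\<^sub>R m = m + h * cos v"
        unfolding gd(4) by (simp add: scaleR_conv_of_real algebra_simps)
      finally show "v \<in> ?U" by simp
    qed
  qed (auto intro!: continuous_intros)
  moreover have "homotopic_with_canon (\<lambda>_. True) ?U ?U (\<lambda>u. of_real (Re u)) (\<lambda>_. 0)"
  proof (rule homotopic_with_linear)
    fix u assume "u \<in> ?U"
    show "closed_segment (complex_of_real (Re u)) 0 \<subseteq> ?U"
    proof
      fix v assume "v \<in> closed_segment (complex_of_real (Re u)) 0"
      then obtain t where "v = of_real ((1 - t) * Re u)"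
        by (auto simp: closed_segment_def scaleR_conv_of_real)
      then show "v \<in> ?U" using real by blast
    qed
  qed (auto intro!: continuous_intros)
  ultimately have "homotopic_with_canon (\<lambda>_. True) ?U ?U id (\<lambda>_. 0)"
    by (meson homotopic_with_sym homotopic_with_trans)
  then show ?thesis unfolding contractible_def by blast
qed


section \<open>Branches of the logarithm and descent through the cosine\<close>

text \<open>The difference is continuous with values in the integer multiples of
  \<open>2 * pi * \<i>\<close>, a discrete set. This is the comparison principle for all the
  logarithms below.\<close>

lemma exp_eq_imp_diff_constant:
  fixes f g :: "'a::topological_space \<Rightarrow> complex"
  assumes "connected S" "continuous_on S f" "continuous_on S g"
    and "\<And>x. x \<in> S \<Longrightarrow> exp (f x) = exp (g x)"
    and "x \<in> S" "y \<in> S"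
  shows "f x - g x = f y - g y"
proof -
  have "(\<lambda>x. f x - g x) constant_on S"
  proof (rule continuous_discrete_range_constant[OF assms(1)])
    show "continuous_on S (\<lambda>x. f x - g x)" by (intro continuous_intros assms)
    fix x assume x: "x \<in> S"
    have mult: "\<exists>n::int. f v - g v = of_real (2 * of_int n * pi) * \<i>" if "v \<in> S" for v
      using assms(4)[OF that] unfolding exp_eq by (auto simp: algebra_simps)
    have "2 * pi \<le> norm ((f y - g y) - (f x - g x))"
      if y: "y \<in> S" and ne: "f y - g y \<noteq> f x - g x" for y
    proof -
      obtain k n :: int where kn: "f x - g x = of_real (2 * of_int k * pi) * \<i>"
        "f y - g y = of_real (2 * of_int n * pi) * \<i>"
        using mult x y by blast
      then have "k \<noteq> n" using ne by auto
      then have "\<bar>real_of_int (n - k)\<bar> \<ge> 1" by linarith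
      have "(f y - g y) - (f x - g x) = of_real (2 * pi * of_int (n - k)) * \<i>"
        unfolding kn by (simp add: algebra_simps)
      then have "norm ((f y - g y) - (f x - g x)) = 2 * pi * \<bar>real_of_int (n - k)\<bar>"
        by (simp only: norm_mult norm_of_real norm_ii abs_mult) simp
      with \<open>\<bar>real_of_int (n - k)\<bar> \<ge> 1\<close> show ?thesis by simp
    qed
    then show "\<exists>e>0. \<forall>y. y \<in> S \<and> f y - g y \<noteq> f x - g x \<longrightarrow> e \<le> norm (f y - g y - (f x - g x))"
      by (intro exI[of _ "2 * pi"]) auto
  qed
  then show ?thesis using assms(5,6) by (auto simp: constant_on_def)
qed

lemma periodic_even_function_of_cos:
  fixes g :: "complex \<Rightarrow> complex"
  assumes even: "\<And>u. u \<in> U \<Longrightarrow> g (- u) = g u"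
    and periodic: "\<And>u. u \<in> U \<Longrightarrow> g (u + 2 * of_real pi) = g u"
    and U: "\<And>u v. cos u = cos v \<Longrightarrow> u \<in> U \<Longrightarrow> v \<in> U"
    and "u \<in> U" "cos u = cos v"
  shows "g u = g v"
proof -
  have U_shift: "w + of_real (2 * of_int n * pi) \<in> U" if "w \<in> U" for w n
    using U[of w] that complex_cos_eq by (metis Ints_of_int)
  have nat: "g (w + of_real (2 * of_int (int n) * pi)) = g w" if "w \<in> U" for w n
  proof (induction n)
    case (Suc n)
    have "g (w + of_real (2 * of_int (int (Suc n)) * pi))
        = g ((w + of_real (2 * of_int (int n) * pi)) + 2 * of_real pi)"
      by (simp add: algebra_simps)
    also have "\<dots> = g w" using Suc periodic U_shift[OF that] by metis
    finally show ?case .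
  qed simp
  have int: "g (w + of_real (2 * of_int n * pi)) = g w" if "w \<in> U" for w n
  proof (cases n rule: int_cases2)
    case (nonpos k)
    \<comment> \<open>Only the forward period is assumed, so a backward shift is undone by a forward
      one starting at the shifted point.\<close>
    have "g ((w + of_real (2 * of_int n * pi)) + of_real (2 * of_int (int k) * pi)) = g (w + of_real (2 * of_int n * pi))"
      by (rule nat[OF U_shift[OF that]])
    then show ?thesis by (simp add: nonpos)
  next
    case (nonneg k)
    show ?thesis unfolding nonneg by (rule nat[OF that])
  qed
  have v: "v \<in> U" using U assms by blast
  obtain n where n: "n \<in> \<int>" "u = v + of_real (2*n*pi) \<or> u = -v + of_real (2*n*pi)"
    using assms(5) unfolding complex_cos_eq by blast
  obtain k :: int where k: "n = of_int k" using n by (auto elim: Ints_cases)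
  have mv: "-v \<in> U" using U[of v "-v"] v by simp
  from n(2) show ?thesis using int[OF v, of k] int[OF mv, of k] even[OF v] unfolding k by auto
qed

text \<open>Invariance of \<open>g\<close> makes its value independent of the chosen preimage under
  \<open>Z\<close>. The descended function is continuous because \<open>Z\<close> is open, and
  holomorphic off the critical values \<open>m + h\<close> and \<open>m - h\<close> because
  \<open>Z\<close> is locally invertible there. Those two points are then removable by
  continuity.\<close>

lemma descend_through_cos:
  fixes m h :: complex
  defines "Z \<equiv> \<lambda>u. m + h * cos u"
  assumes "h \<noteq> 0" "open S" and hol: "g holomorphic_on (Z -` S)"
    and even: "\<And>u. Z u \<in> S \<Longrightarrow> g (- u) = g u"
    and periodic: "\<And>u. Z u \<in> S \<Longrightarrow> g (u + 2 * of_real pi) = g u"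
  obtains G where "G holomorphic_on S" "\<And>u. Z u \<in> S \<Longrightarrow> G (Z u) = g u"
proof -
  \<comment> \<open>\<open>Arccos\<close> is used only as a right inverse of \<open>cos\<close>; its
    branch cuts do no harm, since continuity of \<open>G\<close> is obtained without continuity of
    \<open>A\<close>.\<close>
  define A where "A = (\<lambda>z. Arccos ((z - m) / h))"
  have ZA: "Z (A z) = z" for z using \<open>h \<noteq> 0\<close> by (simp add: Z_def A_def)
  define G where "G = (\<lambda>z. g (A z))"
  have GZ: "G (Z u) = g u" if "Z u \<in> S" for u
    unfolding G_def
  proof (rule periodic_even_function_of_cos[where U = "Z -` S" and g = g and u = "A (Z u)" and v = u])
    show "cos (A (Z u)) = cos u" using \<open>h \<noteq> 0\<close> by (simp add: Z_def A_def)
  qed (use that even periodic ZA in \<open>auto simp: Z_def\<close>)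
  have Z_hol: "Z holomorphic_on T" for T
    unfolding Z_def by (intro holomorphic_intros)
  have deriv_Z: "deriv Z u = - h * sin u" for u
    unfolding Z_def by (rule DERIV_imp_deriv) (auto intro!: derivative_eq_intros)
  have open_Z: "open (Z ` T)" if "open T" for T
  proof (rule open_mapping_thm[OF Z_hol[of UNIV] _ _ that])
    have "Z 0 \<noteq> Z (of_real pi)" using \<open>h \<noteq> 0\<close> by (simp add: Z_def)
    then show "\<not> Z constant_on UNIV" by (metis UNIV_I constant_on_def)
  qed auto
  have open_U: "open (Z -` S)"
    using holomorphic_on_imp_continuous_on[OF Z_hol] \<open>open S\<close> by (simp add: open_vimage)
  have cont: "continuous_on S G"
    unfolding continuous_on_open_vimage[OF \<open>open S\<close>]
  proof (intro allI impI)
    fix T :: "complex set" assume "open T"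
    have "open (g -` T \<inter> Z -` S)"
      using continuous_on_open_vimage[OF open_U] holomorphic_on_imp_continuous_on[OF hol] \<open>open T\<close> by blast
    moreover have "G -` T \<inter> S = Z ` (g -` T \<inter> Z -` S)"
      using GZ ZA by (force simp: G_def)
    ultimately show "open (G -` T \<inter> S)" using open_Z by simp
  qed
  have "G holomorphic_on S"
  proof (rule no_isolated_singularity[OF cont _ \<open>open S\<close>])
    show "G holomorphic_on S - {m + h, m - h}"
    proof (rule holomorphic_on_subset)
      show "G holomorphic_on {z \<in> S. sin (A z) \<noteq> 0}"
      unfolding holomorphic_on_def
      proof
        fix z assume z: "z \<in> {z \<in> S. sin (A z) \<noteq> 0}"
        then have Az: "A z \<in> Z -` S" and d: "deriv Z (A z) \<noteq> 0"
          using ZA \<open>h \<noteq> 0\<close> by (auto simp: deriv_Z)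
        obtain \<rho> where \<rho>: "\<rho> > 0" "ball (A z) \<rho> \<subseteq> Z -` S" "open (Z ` ball (A z) \<rho>)" "inj_on Z (ball (A z) \<rho>)"
          using has_complex_derivative_locally_invertible[OF Z_hol Az open_U d] .
        obtain k where k: "k holomorphic_on (Z ` ball (A z) \<rho>)" "\<And>u. u \<in> ball (A z) \<rho> \<Longrightarrow> k (Z u) = u"
          using holomorphic_has_inverse[OF Z_hol open_ball \<rho>(4)] by metis
        have "g \<circ> k holomorphic_on Z ` ball (A z) \<rho>"
          by (rule holomorphic_on_compose_gen[OF k(1) hol]) (use k \<rho> in auto)
        then have "G holomorphic_on Z ` ball (A z) \<rho>"
          by (rule holomorphic_transform) (use k \<rho> GZ in auto)
        moreover have "z \<in> Z ` ball (A z) \<rho>" using \<rho>(1) ZA by (metis centre_in_ball image_eqI)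
        ultimately show "G field_differentiable at z within {z \<in> S. sin (A z) \<noteq> 0}"
          using holomorphic_on_imp_differentiable_at[OF _ \<rho>(3)] field_differentiable_at_within by blast
      qed
      show "S - {m + h, m - h} \<subseteq> {z \<in> S. sin (A z) \<noteq> 0}"
      proof clarsimp
        fix z assume "z \<noteq> m + h" "z \<noteq> m - h" "sin (A z) = 0"
        then have "(cos (A z))\<^sup>2 = 1" using sin_cos_squared_add[of "A z"] by simp
        then have "cos (A z) = 1 \<or> cos (A z) = -1" by (simp add: power2_eq_1_iff)
        then have "z = m + h \<or> z = m - h" using ZA[of z] by (auto simp: Z_def)
        with \<open>z \<noteq> m + h\<close> \<open>z \<noteq> m - h\<close> show False by blast
      qed
    qed
  qed auto
  with GZ show ?thesis using that by blast
qed

section \<open>The inverse Joukowski map and increments of lifts through cosh\<close>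

text \<open>The branch is w + sqrt (w^2 - 1), written as w (1 + sqrt (1 - 1/w^2)). Off the slit the
  inner radicand avoids the nonpositive reals, so the principal root is continuous, and the bracket
  has positive real part, so it has a principal logarithm. Splitting off \<open>w\<close> leaves a
  single-valued exponent \<open>\<sigma>\<close>: all winding is carried by
  \<open>w\<close>.\<close>

lemma unit_slit_inverse_Joukowski:
  obtains \<sigma> :: "complex \<Rightarrow> complex" where "continuous_on (- of_real ` {-1..1}) \<sigma>"
    "\<And>w. w \<notin> of_real ` {-1..1} \<Longrightarrow> w = (w * exp (\<sigma> w) + inverse (w * exp (\<sigma> w))) / 2"
proof -
  define s where "s = (\<lambda>w::complex. csqrt (1 - 1 / w\<^sup>2))"
  have slit: "1 - 1 / w\<^sup>2 \<notin> \<real>\<^sub>\<le>\<^sub>0" if "w \<notin> of_real ` {-1..1}" for w :: complex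
  proof
    assume "1 - 1 / w\<^sup>2 \<in> \<real>\<^sub>\<le>\<^sub>0"
    then obtain x where x: "x \<le> 0" "1 - 1 / w\<^sup>2 = complex_of_real x" by (auto elim!: nonpos_Reals_cases)
    have w: "w \<noteq> 0" using that by (auto intro: image_eqI[of _ _ 0])
    have ne: "complex_of_real (1 - x) \<noteq> 0" using x(1) by (simp only: of_real_eq_0_iff)
    define y where "y = sqrt (1 / (1 - x))"
    have "1 / w\<^sup>2 = of_real (1 - x)" using x(2) by (simp add: algebra_simps)
    then have "inverse (w\<^sup>2) = of_real (1 - x)" by (simp only: inverse_eq_divide)
    then have "w\<^sup>2 = of_real (1 / (1 - x))" by (metis inverse_eq_divide inverse_inverse_eq of_real_inverse)
    also have "\<dots> = of_real (y\<^sup>2)" using x(1) by (simp add: y_def)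
    finally have "w = of_real y \<or> w = of_real (- y)" by (simp add: power2_eq_iff)
    moreover have "\<bar>y\<bar> \<le> 1" using x(1) by (simp add: y_def)
    ultimately show False using that by (metis abs_le_iff atLeastAtMost_iff image_eqI minus_le_iff neg_le_iff_le)
  qed
  have Re: "Re (1 + s w) > 0" for w using csqrt_principal[of "1 - 1 / w\<^sup>2"] unfolding s_def by (auto simp del: csqrt.sel)
  then have not_nonpos: "1 + s w \<notin> \<real>\<^sub>\<le>\<^sub>0" for w
    unfolding complex_nonpos_Reals_iff by (meson not_le)
  define \<sigma> where "\<sigma> = (\<lambda>w. Ln (1 + s w))"
  show ?thesis
  proof (rule that[of \<sigma>])
    show "continuous_on (- of_real ` {-1..1}) \<sigma>"
      unfolding \<sigma>_def
    proof (intro continuous_intros)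
      show "continuous_on (- of_real ` {-1..1}) s" unfolding s_def
      proof (rule continuous_on_compose2[OF continuous_on_csqrt])
        show "continuous_on (- of_real ` {-1..1}) (\<lambda>w::complex. 1 - 1 / w\<^sup>2)"
          by (intro continuous_intros) (auto intro: image_eqI[of _ _ 0])
      qed (use slit in auto)
    qed (rule not_nonpos)
  next
    fix w :: complex assume "w \<notin> of_real ` {-1..1}"
    then have w: "w \<noteq> 0" by (auto intro: image_eqI[of _ _ 0])
    have exp: "exp (\<sigma> w) = 1 + s w" unfolding \<sigma>_def by (rule exp_Ln) (use not_nonpos[of w] in auto)
    have "(s w)\<^sup>2 = 1 - 1 / w\<^sup>2" by (simp add: s_def)
    then have "(w * (1 + s w)) * (w * (1 - s w)) = 1"
      using w by (simp add: power2_eq_square field_simps)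
    then have "inverse (w * (1 + s w)) = w * (1 - s w)" by (rule inverse_unique)
    then show "w = (w * exp (\<sigma> w) + inverse (w * exp (\<sigma> w))) / 2"
      unfolding exp by (simp add: algebra_simps)
  qed
qed

lemma two_sheets_of_Joukowski:
  fixes x y :: complex
  assumes "x + inverse x = y + inverse y" "x \<noteq> 0" "y \<noteq> 0"
  shows "x = y \<or> x = inverse y"
proof -
  have "(x - y) * (x * y - 1) = 0" using assms by (simp add: field_simps)
  then show ?thesis using assms(3) by (metis eq_iff_diff_eq_0 mult_eq_0_iff inverse_unique mult.commute inverse_inverse_eq)
qed

text \<open>Equal \<open>cosh\<close> forces equal \<open>sinh\<close> up to sign. The ratio of the
  two is continuous with values 1 and -1, so one sign \<epsilon> serves the whole interval, and
  \<open>N\<close> and \<open>\<epsilon> * M\<close> have the same exponential.\<close>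

lemma cosh_lift_increment:
  fixes N M :: "real \<Rightarrow> complex"
  assumes cont: "continuous_on {s..t} N" "continuous_on {s..t} M" and "s \<le> t"
    and cosh: "\<And>\<theta>. \<theta> \<in> {s..t} \<Longrightarrow> cosh (N \<theta>) = cosh (M \<theta>)"
    and sinh: "\<And>\<theta>. \<theta> \<in> {s..t} \<Longrightarrow> sinh (M \<theta>) \<noteq> 0"
  shows "N t - N s = M t - M s \<or> N t - N s = - (M t - M s)"
proof -
  define \<rho> where "\<rho> = (\<lambda>\<theta>. sinh (N \<theta>) / sinh (M \<theta>))"
  have \<rho>: "\<rho> \<theta> = 1 \<or> \<rho> \<theta> = -1" if "\<theta> \<in> {s..t}" for \<theta>
  proof -
    have "(sinh (N \<theta>))\<^sup>2 = (sinh (M \<theta>))\<^sup>2"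
      using cosh[OF that] by (simp add: sinh_square_eq)
    then show ?thesis using sinh[OF that] by (auto simp: \<rho>_def power2_eq_iff)
  qed
  have "\<rho> constant_on {s..t}"
  proof (rule continuous_finite_range_constant)
    show "continuous_on {s..t} \<rho>" unfolding \<rho>_def sinh_field_def
      using sinh by (intro continuous_intros cont) (auto simp: sinh_field_def)
    have "\<rho> ` {s..t} \<subseteq> {1, -1}" using \<rho> by blast
    then show "finite (\<rho> ` {s..t})" by (rule finite_subset) auto
  qed auto
  then obtain \<epsilon> where \<epsilon>: "\<And>\<theta>. \<theta> \<in> {s..t} \<Longrightarrow> \<rho> \<theta> = \<epsilon>" by (auto simp: constant_on_def)
  then have "\<epsilon> = 1 \<or> \<epsilon> = -1" using \<rho>[of s] \<open>s \<le> t\<close> by auto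
  then have eps_odd: "sinh (\<epsilon> * x) = \<epsilon> * sinh x" "cosh (\<epsilon> * x) = cosh x" for x by auto
  have "exp (N \<theta>) = exp (\<epsilon> * M \<theta>)" if "\<theta> \<in> {s..t}" for \<theta>
  proof -
    have "sinh (N \<theta>) = \<epsilon> * sinh (M \<theta>)"
      using \<epsilon>[OF that] sinh[OF that] by (auto simp: \<rho>_def field_simps)
    then show ?thesis using cosh[OF that] by (metis eps_odd sinh_plus_cosh)
  qed
  then have "N t - \<epsilon> * M t = N s - \<epsilon> * M s"
    using \<open>s \<le> t\<close> by (intro exp_eq_imp_diff_constant[of "{s..t}"] continuous_intros cont) auto
  then show ?thesis using \<open>\<epsilon> = 1 \<or> \<epsilon> = -1\<close> by (auto simp: algebra_simps)
qed

lemma cosh_exp_half: "exp w = x \<Longrightarrow> cosh (w::complex) = (x + inverse x) / 2"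
  by (auto simp: cosh_field_def exp_minus)

lemma cosh_triple: "4 * cosh w ^ 3 - 3 * cosh w = cosh (3 * w)" for w :: complex
proof -
  define e where "e = exp w"
  have e: "e \<noteq> 0" by (simp add: e_def)
  have "cosh (3 * w) = (e ^ 3 + inverse (e ^ 3)) / 2"
    by (simp add: cosh_field_def exp_minus e_def exp_of_nat_mult[of 3 w, simplified])
  also have "\<dots> = 4 * ((e + inverse e) / 2) ^ 3 - 3 * ((e + inverse e) / 2)"
    using e by (simp add: field_simps) algebra
  finally show ?thesis by (simp add: cosh_field_def exp_minus e_def)
qed

section \<open>Solving the third Chebyshev equation on a disk\<close>

text \<open>The hypotheses on the unit circle exist to compute the period of the logarithm:
  \<open>q\<close> records that \<open>F\<close> winds three times, and avoidance of the slit makes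
  the inverse Joukowski branch available along the image. The radius \<open>R\<close> exceeds 1 so
  that the circle lies inside the domain.\<close>

lemma Chebyshev_lift:
  fixes F K q :: "complex \<Rightarrow> complex"
  assumes "1 < R" "norm a < 1" "norm b < 1" "a \<noteq> b"
    and hol: "F holomorphic_on ball 0 R" "K holomorphic_on ball 0 R"
    and F2: "\<And>z. z \<in> ball 0 R \<Longrightarrow> (F z)\<^sup>2 - 1 = (z - a) * (z - b) * (K z)\<^sup>2"
    and "F b = 1"
    and circle: "\<And>z. norm z = 1 \<Longrightarrow> F z = z ^ 3 * exp (q z)"
    and q: "continuous_on (sphere 0 1) q"
    and F_slit: "\<And>z. norm z = 1 \<Longrightarrow> F z \<notin> of_real ` {-1..1}"
  obtains G where "G holomorphic_on ball 0 R" "\<And>z. z \<in> ball 0 R \<Longrightarrow> 4 * G z ^ 3 - 3 * G z = F z"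
proof -
  define m h where "m = (a + b) / 2" and "h = (b - a) / 2"
  have ab: "a = m - h" "b = m + h" "h \<noteq> 0"
    using \<open>a \<noteq> b\<close> by (auto simp: m_def h_def field_simps)
  define Z where "Z = (\<lambda>u. m + h * cos u)"
  define U where "U = Z -` ball 0 R"
  have "norm m < 1"
    unfolding m_def using norm_triangle_ineq[of a b] assms(2,3) by (simp add: norm_divide)
  have Z_hol: "Z holomorphic_on T" for T unfolding Z_def by (intro holomorphic_intros)
  have Z_surj: "\<exists>u. Z u = z" for z
    using \<open>h \<noteq> 0\<close> by (intro exI[of _ "Arccos ((z - m) / h)"]) (simp add: Z_def)
  have Z_even: "Z (- u) = Z u" and Z_periodic: "Z (u + 2 * of_real pi) = Z u" for u
    by (simp_all add: Z_def cos_add flip: cos_of_real sin_of_real)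
  have contractible: "contractible U"
    unfolding U_def Z_def vimage_def
    using assms(1-3) ab by (intro contractible_cos_preimage) auto
  then have connected: "connected U" by (rule contractible_imp_connected)
  have U0: "0 \<in> U" using assms(1,3) ab by (simp add: U_def Z_def)
  \<comment> \<open>\<open>E\<close> is \<open>F + sqrt (F\<^sup>2 - 1)\<close>, which becomes single-valued in the variable \<open>u\<close>.\<close>
  define E where "E = (\<lambda>u. F (Z u) + \<i> * h * sin u * K (Z u))"
  have FZ_hol: "(\<lambda>u. F (Z u)) holomorphic_on U" "(\<lambda>u. K (Z u)) holomorphic_on U"
    using holomorphic_on_compose_gen[OF Z_hol hol(1), of U] holomorphic_on_compose_gen[OF Z_hol hol(2), of U]
    by (auto simp: o_def U_def)
  have E_hol: "E holomorphic_on U"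
    unfolding E_def by (intro holomorphic_intros FZ_hol)
  \<comment> \<open>The factor \<open>\<i> * h * sin u\<close> squares to
    \<open>(Z u - a) * (Z u - b)\<close>, so the second factor is F - sqrt (F^2 - 1), the conjugate
    of \<open>E\<close>.\<close>
  have E_inverse: "E u * (F (Z u) - \<i> * h * sin u * K (Z u)) = 1" if "u \<in> U" for u
  proof -
    have "(F (Z u))\<^sup>2 - 1 = (h * cos u + h) * (h * cos u - h) * (K (Z u))\<^sup>2"
      using F2[of "Z u"] that by (simp add: U_def Z_def ab)
    also have "\<dots> = h\<^sup>2 * ((cos u)\<^sup>2 - 1) * (K (Z u))\<^sup>2" by (simp add: power2_eq_square algebra_simps)
    also have "(cos u)\<^sup>2 - 1 = - (sin u)\<^sup>2" by (simp add: sin_squared_eq)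
    finally show ?thesis unfolding E_def
      by (simp add: power2_eq_square algebra_simps)
  qed
  then have E_nz: "E u \<noteq> 0" if "u \<in> U" for u using that by force
  obtain L0 where L0: "L0 holomorphic_on U" "\<And>u. u \<in> U \<Longrightarrow> E u = exp (L0 u)"
    using contractible_imp_holomorphic_log[OF E_hol contractible E_nz] by blast
  \<comment> \<open>Normalized to \<open>L 0 = 0\<close>, the value from which oddness is
    propagated. It is still a logarithm of \<open>E\<close> because \<open>E 0 = 1\<close>, which is
    where \<open>F b = 1\<close> enters.\<close>
  define L where "L = (\<lambda>u. L0 u - L0 0)"
  have L_hol: "L holomorphic_on U" unfolding L_def by (intro holomorphic_intros L0)
  then have L_cont: "continuous_on U L" by (rule holomorphic_on_imp_continuous_on)
  have "E 0 = 1" using \<open>F b = 1\<close> by (simp add: E_def Z_def ab)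
  then have exp_L: "exp (L u) = E u" if "u \<in> U" for u
    using L0(2)[OF that] L0(2)[OF U0] by (simp add: L_def exp_diff)
  have cosh_L: "cosh (L u) = F (Z u)" if "u \<in> U" for u
  proof -
    have "inverse (E u) = F (Z u) - \<i> * h * sin u * K (Z u)"
      using E_inverse[OF that] by (rule inverse_unique)
    then show ?thesis using cosh_exp_half[OF exp_L[OF that]] by (simp add: E_def)
  qed
  have U_minus: "- u \<in> U \<longleftrightarrow> u \<in> U" and U_shift: "u + 2 * of_real pi \<in> U \<longleftrightarrow> u \<in> U" for u
    by (auto simp: U_def Z_even Z_periodic)
  have L_odd: "L (- u) = - L u" if "u \<in> U" for u
  proof -
    have "L (- u) - (- L u) = L (- 0) - (- L 0)"
    proof (rule exp_eq_imp_diff_constant[OF connected _ _ _ that U0])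
      show "continuous_on U (\<lambda>u. L (- u))"
        by (rule continuous_on_compose2[OF L_cont]) (auto intro!: continuous_intros simp: U_minus)
      show "continuous_on U (\<lambda>u. - L u)" by (intro continuous_intros L_cont)
      fix v assume v: "v \<in> U"
      have "exp (L (- v)) = F (Z v) - \<i> * h * sin v * K (Z v)"
        using exp_L[of "- v"] v by (simp add: U_minus E_def Z_even)
      also have "\<dots> = inverse (E v)" using E_inverse[OF v] by (rule inverse_unique[symmetric])
      finally show "exp (L (- v)) = exp (- L v)" using exp_L[OF v] by (simp add: exp_minus)
    qed
    then show ?thesis by (simp add: L_def eq_diff_eq)
  qed
  \<comment> \<open>The increment over one period is the same everywhere on \<open>U\<close>, so it
    may be computed at a point lying over the unit circle.\<close>
  have L_shift: "L (u + 2 * of_real pi) - L u = L (v + 2 * of_real pi) - L v"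
    if "u \<in> U" "v \<in> U" for u v
  proof (rule exp_eq_imp_diff_constant[OF connected _ L_cont _ that])
    show "continuous_on U (\<lambda>u. L (u + 2 * of_real pi))"
      by (rule continuous_on_compose2[OF L_cont]) (auto intro!: continuous_intros simp: U_shift)
    fix v assume v: "v \<in> U"
    have "E (v + 2 * of_real pi) = E v" by (simp add: E_def Z_periodic sin_add flip: cos_of_real sin_of_real)
    then show "exp (L (v + 2 * of_real pi)) = exp (L v)" using v by (simp add: exp_L U_shift)
  qed
  obtain \<sigma> where \<sigma>_cont: "continuous_on (- of_real ` {-1..1}) \<sigma>"
    and \<sigma>: "\<And>w::complex. w \<notin> of_real ` {-1..1} \<Longrightarrow> w = (w * exp (\<sigma> w) + inverse (w * exp (\<sigma> w))) / 2"
    using unit_slit_inverse_Joukowski by blast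
  \<comment> \<open>The affine coordinate sending \<open>a\<close> to -1 and \<open>b\<close> to 1,
    so that \<open>\<zeta> (Z u) = cos u\<close>. The slit corresponds to the segment from
    \<open>a\<close> to \<open>b\<close>, which stays in the open disk and misses the
    circle.\<close>
  define \<zeta> where "\<zeta> = (\<lambda>z. (z - m) / h)"
  have \<zeta>_slit: "\<zeta> z \<notin> of_real ` {-1..1}" if "norm z = 1" for z
  proof
    assume "\<zeta> z \<in> of_real ` {-1..1}"
    then obtain x where x: "-1 \<le> x" "x \<le> 1" "z = m + of_real x * h"
      using ab by (auto simp: \<zeta>_def field_simps)
    have "((1 - x) / 2) *\<^sub>R a + ((1 + x) / 2) *\<^sub>R b \<in> ball 0 1"
      using x assms(2,3) by (intro convexD[OF convex_ball]) (auto simp: field_simps)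
    also have "((1 - x) / 2) *\<^sub>R a + ((1 + x) / 2) *\<^sub>R b = z"
      unfolding x(3) ab by (simp add: scaleR_conv_of_real field_simps)
    finally show False using that by simp
  qed
  \<comment> \<open>On the circle \<open>z * exp (q1 z)\<close> and
    \<open>z ^ 3 * exp (q2 z)\<close> are the Joukowski preimages of \<open>\<zeta> z\<close> and
    \<open>F z\<close>. Both exponents are single-valued, so only the powers of \<open>z\<close>
    contribute after a full turn.\<close>
  define q1 where "q1 = (\<lambda>z. Ln (1 - m / z) - Ln h + \<sigma> (\<zeta> z))"
  define q2 where "q2 = (\<lambda>z. q z + \<sigma> (F z))"
  have Re_m: "Re (1 - m / z) > 0" if "norm z = 1" for z
  proof -
    have "\<bar>Re (m / z)\<bar> \<le> norm (m / z)" by (rule abs_Re_le_cmod)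
    also have "\<dots> < 1" using that \<open>norm m < 1\<close> by (simp add: norm_divide)
    finally show ?thesis by simp
  qed
  have cont_q1: "continuous_on (sphere 0 1) q1" unfolding q1_def
  proof (intro continuous_intros)
    have "continuous_on (sphere 0 1) \<zeta>" unfolding \<zeta>_def using ab by (intro continuous_intros) auto
    then show "continuous_on (sphere 0 1) (\<lambda>z. \<sigma> (\<zeta> z))"
      by (rule continuous_on_compose2[OF \<sigma>_cont]) (use \<zeta>_slit in \<open>force simp: image_iff\<close>)
  qed (use Re_m in \<open>auto simp: complex_nonpos_Reals_iff\<close>, force+)
  have cont_q2: "continuous_on (sphere 0 1) q2" unfolding q2_def
  proof (intro continuous_intros q)
    have "continuous_on (sphere 0 1) F"
      by (rule continuous_on_subset[OF holomorphic_on_imp_continuous_on[OF hol(1)]]) (use \<open>1 < R\<close> in auto)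
    then show "continuous_on (sphere 0 1) (\<lambda>z. \<sigma> (F z))"
      by (rule continuous_on_compose2[OF \<sigma>_cont]) (use F_slit in \<open>force simp: image_iff\<close>)
  qed
  \<comment> \<open>Lifting one turn of the unit circle to the \<open>u\<close>-plane computes the period of \<open>L\<close>:
    \<open>\<zeta> = cos w\<close> winds once and \<open>F = cosh M\<close> three times.\<close>
  define w where "w = (\<lambda>\<theta>::real. \<i> * (\<i> * of_real \<theta> + q1 (cis \<theta>)))"
  define M where "M = (\<lambda>\<theta>::real. 3 * (\<i> * of_real \<theta>) + q2 (cis \<theta>))"
  have w_cont: "continuous_on {0..2*pi} w" unfolding w_def
    by (intro continuous_intros continuous_on_compose2[OF cont_q1]) auto
  have M_cont: "continuous_on {0..2*pi} M" unfolding M_def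
    by (intro continuous_intros continuous_on_compose2[OF cont_q2]) auto
  have Z_w: "Z (w \<theta>) = cis \<theta>" for \<theta>
  proof -
    define z where "z = cis \<theta>"
    have z: "norm z = 1" "z \<noteq> 0" by (auto simp: z_def)
    have "exp (- (\<i> * w \<theta>)) = exp (\<i> * of_real \<theta>) * exp (q1 z)"
      by (simp add: w_def z_def exp_add[symmetric] algebra_simps flip: mult.assoc)
    also have "\<dots> = z * ((1 - m / z) / h * exp (\<sigma> (\<zeta> z)))"
      unfolding q1_def exp_add exp_diff using Re_m[OF z(1)] ab
      by (subst exp_Ln, force, subst exp_Ln) (auto simp: z_def cis_conv_exp)
    also have "\<dots> = \<zeta> z * exp (\<sigma> (\<zeta> z))" using z ab by (simp add: \<zeta>_def field_simps)
    finally have e: "exp (- (\<i> * w \<theta>)) = \<zeta> z * exp (\<sigma> (\<zeta> z))" .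
    have "cos (w \<theta>) = cosh (- (\<i> * w \<theta>))" by (simp add: cosh_field_def cos_exp_eq)
    also have "\<dots> = \<zeta> z" unfolding cosh_exp_half[OF e] by (rule \<sigma>[OF \<zeta>_slit[OF z(1)], symmetric])
    finally show ?thesis using ab by (simp add: Z_def \<zeta>_def z_def)
  qed
  have w_U: "w \<theta> \<in> U" for \<theta> using Z_w \<open>1 < R\<close> by (simp add: U_def)
  have cosh_M: "cosh (M \<theta>) = F (cis \<theta>)" for \<theta>
  proof -
    have "exp (3 * (\<i> * of_real \<theta>)) = cis \<theta> ^ 3"
      unfolding cis_conv_exp by (simp flip: exp_of_nat_mult)
    then have "exp (M \<theta>) = F (cis \<theta>) * exp (\<sigma> (F (cis \<theta>)))"
      by (simp add: M_def q2_def exp_add circle)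
    then have "cosh (M \<theta>) = (F (cis \<theta>) * exp (\<sigma> (F (cis \<theta>))) + inverse (F (cis \<theta>) * exp (\<sigma> (F (cis \<theta>))))) / 2"
      by (rule cosh_exp_half)
    also have "\<dots> = F (cis \<theta>)" by (rule \<sigma>[OF F_slit, symmetric]) simp
    finally show ?thesis .
  qed
  have sinh_M: "sinh (M \<theta>) \<noteq> 0" for \<theta>
  proof
    assume "sinh (M \<theta>) = 0"
    then have "(F (cis \<theta>))\<^sup>2 = 1" using cosh_square_eq[of "M \<theta>"] by (simp add: cosh_M)
    then have "F (cis \<theta>) = of_real 1 \<or> F (cis \<theta>) = of_real (-1)" by (simp add: power2_eq_1_iff)
    then show False using F_slit[of "cis \<theta>"] by force
  qed
  have "L (w (2*pi)) - L (w 0) = M (2*pi) - M 0 \<or> L (w (2*pi)) - L (w 0) = - (M (2*pi) - M 0)"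
  proof (rule cosh_lift_increment)
    show "continuous_on {0..2*pi} (\<lambda>\<theta>. L (w \<theta>))"
      by (rule continuous_on_compose2[OF L_cont w_cont]) (use w_U in auto)
  qed (use M_cont sinh_M w_U in \<open>auto simp: cosh_L cosh_M Z_w\<close>)
  moreover have "M (2*pi) - M 0 = 6 * of_real pi * \<i>" by (simp add: M_def)
  \<comment> \<open>The product \<open>\<i> * \<i>\<close> in \<open>w\<close> reverses the
    direction: one positive turn of the circle lowers \<open>w\<close> by
    \<open>2 * pi\<close>.\<close>
  moreover have "w 0 = w (2*pi) + 2 * of_real pi" by (simp add: w_def distrib_left flip: mult.assoc)
  ultimately have *: "L (w (2*pi) + 2 * of_real pi) - L (w (2*pi)) = 6 * of_real pi * \<i> \<or>
      L (w (2*pi) + 2 * of_real pi) - L (w (2*pi)) = - (6 * of_real pi * \<i>)"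
    by (auto simp: algebra_simps)
  then have period: "L (u + 2 * of_real pi) = L u + 6 * of_real pi * \<i> \<or>
      L (u + 2 * of_real pi) = L u - 6 * of_real pi * \<i>" if "u \<in> U" for u
  proof -
    have "L (u + 2 * of_real pi) = L u + (L (w (2*pi) + 2 * of_real pi) - L (w (2*pi)))"
      using L_shift[OF that w_U[of "2*pi"]] by (metis add_diff_cancel_left' add.commute diff_add_cancel)
    with * show ?thesis by (metis diff_conv_add_uminus)
  qed
  define g where "g = (\<lambda>u. cosh (L u / 3))"
  have g_hol: "g holomorphic_on Z -` ball 0 R"
    using L_hol unfolding g_def cosh_field_def U_def by (intro holomorphic_intros) auto
  have g_even: "g (- u) = g u" if "u \<in> U" for u
    using L_odd[OF that] by (simp add: g_def)
  have g_periodic: "g (u + 2 * of_real pi) = g u" if "u \<in> U" for u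
  proof -
    have "cosh (x + 2 * of_real pi * \<i>) = cosh x" "cosh (x - 2 * of_real pi * \<i>) = cosh x" for x :: complex
      by (auto simp: cosh_field_def exp_add exp_diff exp_minus field_simps)
    from this(1)[of "L u / 3"] this(2)[of "L u / 3"] period[OF that] show ?thesis
      by (auto simp: g_def add_divide_distrib diff_divide_distrib mult_ac)
  qed
  obtain G where G: "G holomorphic_on ball 0 R" "\<And>u. Z u \<in> ball 0 R \<Longrightarrow> G (Z u) = g u"
  proof (rule descend_through_cos[of h "ball 0 R" g m])
    show "g holomorphic_on (\<lambda>u. m + h * cos u) -` ball 0 R" using g_hol by (simp only: Z_def)
    fix u assume "m + h * cos u \<in> ball 0 R"
    then have "u \<in> U" by (simp add: U_def Z_def)
    then show "g (- u) = g u" "g (u + 2 * of_real pi) = g u" by (rule g_even, rule g_periodic)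
  next
    fix G assume "G holomorphic_on ball 0 R"
      "\<And>u. m + h * cos u \<in> ball 0 R \<Longrightarrow> G (m + h * cos u) = g u"
    then show thesis using that by (simp add: Z_def)
  qed (use ab in auto)
  have "4 * G z ^ 3 - 3 * G z = F z" if "z \<in> ball 0 R" for z
  proof -
    obtain u where u: "Z u = z" using Z_surj by blast
    then have "u \<in> U" using that by (simp add: U_def)
    then show ?thesis using G(2)[of u] that u cosh_triple[of "L u / 3"] cosh_L by (simp add: g_def)
  qed
  with G(1) show ?thesis using that by blast
qed

section \<open>Finite Blaschke products as rational functions\<close>

lemma blaschke_productE:
  assumes "blaschke_product n B"
  obtains l a where "norm l = 1" "\<forall>j\<in>{1..n}. norm (a j) < 1" "n \<ge> 1"
    "B = (\<lambda>z. l * (\<Prod>j=1..n. (z - a j) / (1 - cnj (a j) * z)))"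
proof -
  obtain l a where "norm l = 1" and a: "\<forall>j\<in>{1..n}. a j \<in> unit_disk" and "n \<ge> 1"
    "B = (\<lambda>z. l * (\<Prod>j=1..n. (z - a j) / (1 - cnj (a j) * z)))"
    using assms unfolding blaschke_product_def by blast
  moreover have "\<forall>j\<in>{1..n}. norm (a j) < 1" using a by simp
  ultimately show ?thesis using that by blast
qed

text \<open>For \<open>a\<close> in the disk the first factor on the right is positive, so the sign
  of \<open>1 - (norm z)\<^sup>2\<close> decides which of numerator and denominator is
  larger.\<close>

lemma Blaschke_factor_norm_diff:
  "(norm (1 - cnj a * z))\<^sup>2 - (norm (z - a))\<^sup>2 = (1 - (norm a)\<^sup>2) * (1 - (norm z)\<^sup>2)"
proof -
  have "complex_of_real ((norm (1 - cnj a * z))\<^sup>2 - (norm (z - a))\<^sup>2)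
      = complex_of_real ((1 - (norm a)\<^sup>2) * (1 - (norm z)\<^sup>2))"
    unfolding of_real_diff of_real_mult of_real_1 complex_norm_square by (simp add: algebra_simps)
  then show ?thesis by (simp only: of_real_eq_iff)
qed

lemma
  fixes a z :: complex
  assumes "norm a < 1"
  shows Blaschke_factor_norm_less: "norm z < 1 \<Longrightarrow> norm (z - a) < norm (1 - cnj a * z)"
    and Blaschke_factor_norm_eq: "norm z = 1 \<Longrightarrow> norm (z - a) = norm (1 - cnj a * z)"
    and Blaschke_factor_norm_ge: "norm z \<ge> 1 \<Longrightarrow> norm (1 - cnj a * z) \<le> norm (z - a)"
proof -
  have a: "1 - (norm a)\<^sup>2 > 0" using assms by (simp add: power_less_one_iff)
  note diff = Blaschke_factor_norm_diff[of a z]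
  show "norm (z - a) < norm (1 - cnj a * z)" if "norm z < 1"
  proof -
    have "1 - (norm z)\<^sup>2 > 0" using that by (simp add: power_less_one_iff)
    with a have "0 < (1 - (norm a)\<^sup>2) * (1 - (norm z)\<^sup>2)" by (rule mult_pos_pos)
    with diff have "(norm (z - a))\<^sup>2 < (norm (1 - cnj a * z))\<^sup>2" by linarith
    then show ?thesis by (rule power2_less_imp_less) simp
  qed
  show "norm (z - a) = norm (1 - cnj a * z)" if "norm z = 1"
    using diff that by (intro power2_eq_imp_eq[of "norm (z - a)"]) simp_all
  show "norm (1 - cnj a * z) \<le> norm (z - a)" if "norm z \<ge> 1"
  proof -
    have "1 - (norm z)\<^sup>2 \<le> 0" using that by (simp add: one_le_power)
    with a have "(1 - (norm a)\<^sup>2) * (1 - (norm z)\<^sup>2) \<le> 0" by (simp add: mult_nonneg_nonpos)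
    with diff have "(norm (1 - cnj a * z))\<^sup>2 \<le> (norm (z - a))\<^sup>2" by linarith
    then show ?thesis by (rule power2_le_imp_le) simp
  qed
qed

text \<open>A degree bound together with the \<open>n\<close>-th coefficient, rather than an exact
  degree, because some \<open>c j\<close> may be 0: the denominator of a Blaschke product loses
  degree for each zero at the origin.\<close>

lemma
  fixes b c :: "nat \<Rightarrow> 'a::comm_ring_1"
  shows degree_prod_linear_le: "degree (\<Prod>j=1..n. [:b j, c j:]) \<le> n"
    and coeff_prod_linear: "coeff (\<Prod>j=1..n. [:b j, c j:]) n = (\<Prod>j=1..n. c j)"
proof (induction n)
  case (Suc n)
  let ?P = "\<Prod>j=1..n. [:b j, c j:]"
  have prod: "(\<Prod>j=1..Suc n. [:b j, c j:]) = smult (b (Suc n)) ?P + pCons 0 (smult (c (Suc n)) ?P)"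
    by (simp add: mult.commute)
  {
    case 1
    have "degree (smult (b (Suc n)) ?P) \<le> Suc n"
      by (rule order.trans[OF degree_smult_le]) (rule le_SucI[OF Suc.IH(1)])
    moreover have "degree (smult (c (Suc n)) ?P) \<le> n"
      by (rule order.trans[OF degree_smult_le Suc.IH(1)])
    then have "degree (pCons 0 (smult (c (Suc n)) ?P)) \<le> Suc n"
      by (intro order.trans[OF degree_pCons_le]) simp
    ultimately show ?case unfolding prod by (rule degree_add_le)
  next
    case 2
    have "coeff ?P (Suc n) = 0" using Suc.IH(1) by (intro coeff_eq_0) simp
    then show ?case unfolding prod using Suc.IH(2) by (simp add: mult.commute)
  }
qed simp_all

text \<open>Comparing factors gives |N| < |D| inside the disk, equality on the circle and |N| >= |D|
  outside. Hence N = k D with |k| < 1 has no solution outside. The top coefficient of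
  \<open>N - smult k D\<close> is \<open>l\<close> minus a number of modulus below 1, so the degree
  does not drop. Fibres over the disk thus become root sets of polynomials of degree
  \<open>n\<close>.\<close>

lemma Blaschke_product_rational:
  assumes "blaschke_product n B"
  obtains N D :: "complex poly" and R :: real where "1 < R"
    "\<And>z. B z = poly N z / poly D z"
    "\<And>z. norm z < R \<Longrightarrow> poly D z \<noteq> 0"
    "\<And>z. norm z < 1 \<Longrightarrow> norm (B z) < 1"
    "\<And>z. norm z = 1 \<Longrightarrow> norm (B z) = 1"
    "\<And>k z. norm k < 1 \<Longrightarrow> poly (N - smult k D) z = 0 \<Longrightarrow> norm z < 1 \<and> B z = k"
    "\<And>k. norm k < 1 \<Longrightarrow> degree (N - smult k D) = n"
proof -
  obtain l a where l: "norm l = 1" and norm_a: "\<forall>j\<in>{1..n}. norm (a j) < 1" and "n \<ge> 1"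
    and B: "B = (\<lambda>z. l * (\<Prod>j=1..n. (z - a j) / (1 - cnj (a j) * z)))"
    using assms by (rule blaschke_productE)
  have a: "norm (a j) < 1" if "j \<in> {1..n}" for j using norm_a that by blast
  define N where "N = smult l (\<Prod>j=1..n. [:- a j, 1:])"
  define D where "D = (\<Prod>j=1..n. [:1, - cnj (a j):])"
  have N: "poly N z = l * (\<Prod>j=1..n. z - a j)" and D: "poly D z = (\<Prod>j=1..n. 1 - cnj (a j) * z)" for z
    by (simp_all add: N_def D_def poly_prod mult.commute)
  have B_eq: "B z = poly N z / poly D z" for z by (simp add: B N D prod_dividef)
  \<comment> \<open>The entry 1/2 keeps \<open>m\<close> positive when all zeros are at the origin,
    so that \<open>1 / m\<close> is a radius greater than 1.\<close>
  define m where "m = Max (insert (1/2) ((\<lambda>j. norm (a j)) ` {1..n}))"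
  have m: "0 < m" "m < 1" using a by (auto simp: m_def Max_gr_iff)
  have a_m: "norm (a j) \<le> m" if "j \<in> {1..n}" for j
    unfolding m_def using that by (intro Max_ge) auto
  have D_nz: "poly D z \<noteq> 0" if "norm z < 1 / m" for z
  proof
    assume "poly D z = 0"
    then obtain j where j: "j \<in> {1..n}" "cnj (a j) * z = 1" by (auto simp: D)
    have "norm (a j) * norm z \<le> m * norm z" using a_m[OF j(1)] by (intro mult_right_mono) auto
    also have "\<dots> < 1" using that m by (simp add: field_simps)
    finally show False using arg_cong[OF j(2), of norm] by (simp add: norm_mult)
  qed
  have less: "norm (poly N z) < norm (poly D z)" if "norm z < 1" for z
  proof -
    have "norm (poly N z) = (\<Prod>j=1..n. norm (z - a j))" by (simp add: N l norm_mult flip: prod_norm)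
    also have "\<dots> < (\<Prod>j=1..n. norm (1 - cnj (a j) * z))"
    proof (rule prod_mono_strict[of 1])
      show "norm (1 - cnj (a j) * z) > 0" if "j \<in> {1..n}" for j
        using Blaschke_factor_norm_less[OF a[OF that] \<open>norm z < 1\<close>] norm_ge_zero le_less_trans by blast
    qed (use Blaschke_factor_norm_less[OF a \<open>norm z < 1\<close>] \<open>n \<ge> 1\<close> in \<open>auto intro: less_imp_le\<close>)
    finally show ?thesis by (simp add: D flip: prod_norm)
  qed
  have eq: "norm (poly N z) = norm (poly D z)" if "norm z = 1" for z
    using Blaschke_factor_norm_eq[OF a that] by (simp add: N D l norm_mult flip: prod_norm)
  have ge: "norm (poly D z) \<le> norm (poly N z)" if "norm z \<ge> 1" for z
    unfolding N D norm_mult l prod_norm[symmetric] mult_1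
    by (intro prod_mono conjI norm_ge_zero Blaschke_factor_norm_ge a that)
  have N_nz: "poly N z \<noteq> 0" if "norm z \<ge> 1" for z
    using a that l by (force simp: N)
  have disk: "norm z < 1 / m" if "norm z \<le> 1" for z :: complex
  proof -
    have "1 < 1 / m" using m by simp
    with that show ?thesis by (rule le_less_trans)
  qed
  show ?thesis
  proof (rule that[of "1 / m" N D])
    show "1 < 1 / m" using m by simp
    show "norm (B z) < 1" if "norm z < 1" for z
      using less[OF that] D_nz[OF disk] that by (simp add: B_eq norm_divide)
    show "norm (B z) = 1" if "norm z = 1" for z
      using eq[OF that] D_nz[OF disk] that by (simp add: B_eq norm_divide)
  next
    fix k z assume k: "norm k < 1" and "poly (N - smult k D) z = 0"
    then have root: "poly N z = k * poly D z" by simp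
    have "norm z < 1"
    proof (rule ccontr)
      assume "\<not> norm z < 1"
      then have z: "norm z \<ge> 1" by simp
      \<comment> \<open>A zero of \<open>D\<close> here would be a zero of \<open>N\<close> by the
        root equation, and \<open>N\<close> has none outside the open disk.\<close>
      then have "poly D z \<noteq> 0" using N_nz[OF z] root by auto
      then have "norm (poly N z) < norm (poly D z)" using k by (simp add: root norm_mult)
      then show False using ge[OF z] by simp
    qed
    then show "norm z < 1 \<and> B z = k" using D_nz[OF disk, of z] root by (simp add: B_eq)
  next
    fix k :: complex assume k: "norm k < 1"
    have "coeff D n = (\<Prod>j=1..n. - cnj (a j))" unfolding D_def by (rule coeff_prod_linear)
    then have "norm (coeff D n) = (\<Prod>j=1..n. norm (a j))" by (simp flip: prod_norm)
    also have "\<dots> \<le> 1" using a by (intro prod_le_1) (auto intro: less_imp_le)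
    finally have "norm (k * coeff D n) < 1"
      using k mult_left_le[of "norm (coeff D n)" "norm k"] by (simp add: norm_mult)
    moreover have "coeff N n = l" using coeff_prod_linear[of "\<lambda>j. - a j" "\<lambda>_. 1" n] by (simp add: N_def)
    ultimately have "coeff (N - smult k D) n \<noteq> 0" using l by auto
    then have "n \<le> degree (N - smult k D)" by (rule le_degree)
    moreover have "degree (N - smult k D) \<le> n"
      unfolding N_def D_def
      by (intro degree_diff_le order.trans[OF degree_smult_le] degree_prod_linear_le)
    ultimately show "degree (N - smult k D) = n" by simp
  qed (use B_eq D_nz in auto)
qed

text \<open>On the circle each factor is \<open>z\<close> times the quotient of
  \<open>1 - a j / z\<close> by \<open>1 - cnj (a j) * z\<close>. Both have the form 1 - w with |w|
  < 1, so principal logarithms apply.\<close>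

lemma Blaschke_product_log_on_circle:
  assumes "blaschke_product n B"
  obtains q where "continuous_on (sphere 0 1) q" "\<And>z. norm z = 1 \<Longrightarrow> B z = z ^ n * exp (q z)"
proof -
  obtain l a where l: "norm l = 1" and norm_a: "\<forall>j\<in>{1..n}. norm (a j) < 1" and "n \<ge> 1"
    and B: "B = (\<lambda>z. l * (\<Prod>j=1..n. (z - a j) / (1 - cnj (a j) * z)))"
    using assms by (rule blaschke_productE)
  have a: "norm (a j) < 1" if "j \<in> {1..n}" for j using norm_a that by blast
  have Re: "1 - w \<notin> \<real>\<^sub>\<le>\<^sub>0" if "norm w < 1" for w :: complex
    using that abs_Re_le_cmod[of w] by (auto simp: complex_nonpos_Reals_iff)
  define q where "q = (\<lambda>z. Ln l + (\<Sum>j=1..n. Ln (1 - a j / z) - Ln (1 - cnj (a j) * z)))"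
  have slit: "1 - a j / z \<notin> \<real>\<^sub>\<le>\<^sub>0" "1 - cnj (a j) * z \<notin> \<real>\<^sub>\<le>\<^sub>0" if "j \<in> {1..n}" "norm z = 1" for j z
    using a[OF that(1)] that(2) by (auto intro!: Re simp: norm_divide norm_mult)
  show ?thesis
  proof (rule that[of q])
    show "continuous_on (sphere 0 1) q"
      unfolding q_def by (intro continuous_intros slit) auto
    fix z :: complex assume z: "norm z = 1"
    have "l \<noteq> 0" using l by auto
    then have "z ^ n * exp (q z) = l * (z ^ n * (\<Prod>j=1..n. exp (Ln (1 - a j / z) - Ln (1 - cnj (a j) * z))))"
      by (simp add: q_def exp_add exp_sum)
    also have "(\<Prod>j=1..n. exp (Ln (1 - a j / z) - Ln (1 - cnj (a j) * z)))
        = (\<Prod>j=1..n. (1 - a j / z) / (1 - cnj (a j) * z))"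
    proof (rule prod.cong)
      fix j assume "j \<in> {1..n}"
      then have "1 - a j / z \<noteq> 0" "1 - cnj (a j) * z \<noteq> 0" using slit[of j z] z by auto
      then show "exp (Ln (1 - a j / z) - Ln (1 - cnj (a j) * z)) = (1 - a j / z) / (1 - cnj (a j) * z)"
        by (simp add: exp_diff)
    qed simp
    also have "z ^ n * \<dots> = (\<Prod>j=1..n. z * ((1 - a j / z) / (1 - cnj (a j) * z)))"
      by (simp only: prod.distrib prod_constant card_atLeastAtMost diff_Suc_1)
    also have "\<dots> = (\<Prod>j=1..n. (z - a j) / (1 - cnj (a j) * z))"
      using z by (intro prod.cong) (auto simp: field_simps)
    finally show "B z = z ^ n * exp (q z)" by (simp add: B)
  qed
qed

section \<open>Double roots, and the sets where a polynomial is below one in modulus\<close>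

lemma cubic_with_double_root:
  fixes P :: "complex poly"
  assumes "degree P = 3" "poly P z = 0" "poly (pderiv P) z = 0"
  obtains C a where "C \<noteq> 0" "P = smult C ([:- z, 1:]\<^sup>2 * [:- a, 1:])"
proof -
  obtain Q where Q: "P = [:- z, 1:] * Q" using assms(2) by (auto simp: poly_eq_0_iff_dvd elim: dvdE)
  have "pderiv P = Q + [:- z, 1:] * pderiv Q"
    unfolding Q pderiv_mult by (simp add: pderiv_pCons)
  then have "poly Q z = 0" using assms(3) by simp
  then obtain T where T: "Q = [:- z, 1:] * T" by (auto simp: poly_eq_0_iff_dvd elim: dvdE)
  have P: "P = [:- z, 1:]\<^sup>2 * T" unfolding Q T by (simp only: power2_eq_square mult.assoc)
  have "T \<noteq> 0" using assms(1) P by auto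
  then have "degree P = 2 + degree T"
    unfolding P by (subst degree_mult_eq) (auto simp: degree_power_eq)
  then have "degree T = 1" using assms(1) by simp
  then obtain u v where T_eq: "T = [:u, v:]" "v \<noteq> 0"
    by (rule degree1_coeffs)
  then have "T = smult v [:- (- u / v), 1:]" by simp
  then have "P = smult v ([:- z, 1:]\<^sup>2 * [:- (- u / v), 1:])"
    unfolding P by (metis mult_smult_right)
  then show ?thesis using that T_eq(2) by blast
qed

lemma open_poly_disk: "open (poly_disk p)"
proof -
  have "poly_disk p = poly p -` ball 0 1" by (auto simp: poly_disk_def)
  then show ?thesis by (simp add: open_vimage continuous_on_poly)
qed

lemma bounded_poly_disk:
  assumes "degree p > 0"
  shows "bounded (poly_disk p)"
proof -
  obtain c q where p: "p = pCons c q" by (cases p)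
  then have "q \<noteq> 0" using assms by auto
  then obtain M where M: "\<And>z. M \<le> norm z \<Longrightarrow> 1 \<le> norm (poly p z)"
    using poly_infinity[of q 1 c] p by auto
  have "norm z \<le> M" if "z \<in> poly_disk p" for z
  proof (rule ccontr)
    assume "\<not> norm z \<le> M"
    then have "1 \<le> norm (poly p z)" using M by simp
    with that show False by (simp add: poly_disk_def)
  qed
  then show ?thesis by (auto simp: bounded_iff)
qed

text \<open>The image is open by the open mapping theorem. It is closed in the disk because
  \<open>closure V\<close> is compact and its points outside \<open>V\<close> lie outside
  \<open>poly_disk p\<close>. Connectedness of the disk then leaves no other choice.\<close>

lemma poly_clopen_part_of_poly_disk_surj:
  assumes "degree p > 0" "V \<subseteq> poly_disk p" "V \<noteq> {}" "open V" "open (poly_disk p - V)"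
  shows "poly p ` V = unit_disk"
proof -
  have sub: "poly p ` V \<subseteq> unit_disk" using assms(2) by (auto simp: poly_disk_def)
  have "compact (closure V)"
    using bounded_poly_disk[OF assms(1)] assms(2) bounded_subset compact_closure by blast
  then have closed: "closed (poly p ` closure V)"
    by (intro compact_imp_closed compact_continuous_image continuous_on_poly continuous_on_id)
  have "poly p ` V = unit_disk \<inter> poly p ` closure V"
  proof
    show "poly p ` V \<subseteq> unit_disk \<inter> poly p ` closure V" using sub closure_subset by blast
    show "unit_disk \<inter> poly p ` closure V \<subseteq> poly p ` V"
    proof clarify
      fix x assume x: "x \<in> closure V" "poly p x \<in> unit_disk"
      have "(poly_disk p - V) \<inter> closure V = {}"
        using open_Int_closure_eq_empty[OF assms(5)] by auto
      moreover have "x \<in> poly_disk p" using x(2) by (simp add: poly_disk_def)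
      ultimately show "poly p x \<in> poly p ` V" using x(1) by blast
    qed
  qed
  then have "closedin (top_of_set unit_disk) (poly p ` V)" using closed by (metis closedin_closed_Int)
  moreover have "open (poly p ` V)"
  proof (rule open_mapping_thm[of _ UNIV])
    show "\<not> poly p constant_on UNIV"
    proof
      assume "poly p constant_on UNIV"
      then obtain c where "\<And>z. poly p z = c" by (auto simp: constant_on_def)
      then have "poly p = poly [:c:]" by auto
      then have "p = [:c:]" by (simp add: poly_eq_poly_eq_iff)
      then show False using assms(1) by simp
    qed
  qed (use assms in \<open>auto intro: holomorphic_intros\<close>)
  then have "openin (top_of_set unit_disk) (poly p ` V)" using sub by (simp add: open_openin_trans)
  ultimately show ?thesis
    using connected_clopen[of unit_disk] assms(3) by auto
qed

section \<open>The Chebyshev cubic\<close>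

text \<open>With T(s) = 4 s^3 - 3 s the polynomial is d + 2 r^3 T(w / (2 r)). Its critical points
  are \<open>r\<close> and \<open>- r\<close>, and the two bounded quantities are its critical
  values there, in this order.\<close>

locale Chebyshev_cubic =
  fixes r d :: complex and p :: "complex poly"
  assumes r: "r \<noteq> 0"
    and critical: "norm (d - 2 * r ^ 3) < 1" "norm (d + 2 * r ^ 3) < 1"
    and p_def: "p = [:d, - 3 * r\<^sup>2, 0, 1:]"
begin

lemma poly_p: "poly p w = w ^ 3 - 3 * r\<^sup>2 * w + d"
  by (simp add: p_def power2_eq_square power3_eq_cube algebra_simps)

lemma degree_p: "degree p > 0"
  by (simp add: p_def)

lemma poly_p_fibre_minus:
  "poly p w = d - 2 * r ^ 3 \<longleftrightarrow> w = r \<or> w = - 2 * r"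
proof -
  have "poly p w - (d - 2 * r ^ 3) = (w - r)\<^sup>2 * (w + 2 * r)"
    unfolding poly_p by algebra
  then have "poly p w = d - 2 * r ^ 3 \<longleftrightarrow> (w - r)\<^sup>2 * (w + 2 * r) = 0" by (metis right_minus_eq)
  then show ?thesis by (auto simp: add_eq_0_iff2)
qed

text \<open>The Chebyshev polynomial maps [-1, 1] to itself, so \<open>p\<close> maps this segment
  into the segment joining the two critical values, which lies in the convex unit disk.\<close>

lemma segment_subset_poly_disk: "closed_segment (- 2 * r) (2 * r) \<subseteq> poly_disk p"
proof
  fix w assume "w \<in> closed_segment (- 2 * r) (2 * r)"
  then obtain t where t: "0 \<le> t" "t \<le> 1" "w = (1 - t) *\<^sub>R (- 2 * r) + t *\<^sub>R (2 * r)"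
    by (auto simp: closed_segment_def)
  define s where "s = 2 * t - 1"
  have s: "-1 \<le> s" "s \<le> 1" using t by (auto simp: s_def)
  have w: "w = 2 * r * of_real s"
    unfolding t(3) s_def scaleR_conv_of_real by (simp add: algebra_simps)
  define T where "T = 4 * s ^ 3 - 3 * s"
  have "T = cos (3 * arccos s)" using s by (simp add: T_def cos_treble_cos)
  then have T: "-1 \<le> T" "T \<le> 1" by auto
  have "poly p w = d + 2 * r ^ 3 * of_real T"
    unfolding poly_p w T_def by (simp add: power2_eq_square power3_eq_cube algebra_simps)
  also have "\<dots> = ((1 - T) / 2) *\<^sub>R (d - 2 * r ^ 3) + ((1 + T) / 2) *\<^sub>R (d + 2 * r ^ 3)"
    by (simp add: scaleR_conv_of_real field_simps)
  also have "\<dots> \<in> ball 0 1"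
    using critical T by (intro convexD[OF convex_ball]) (auto simp: field_simps)
  finally show "w \<in> poly_disk p" by (simp add: poly_disk_def)
qed

text \<open>Both pieces of a separation would contain a preimage of \<open>d - 2 * r ^ 3\<close>.
  All such preimages lie on one segment inside \<open>poly_disk p\<close>, and a segment cannot be
  separated.\<close>

lemma clopen_part_of_poly_disk:
  assumes "V \<subseteq> poly_disk p" "V \<noteq> {}" "open V" "open (poly_disk p - V)"
  shows "V = poly_disk p"
proof (rule ccontr)
  assume "V \<noteq> poly_disk p"
  define W where "W = poly_disk p - V"
  have W: "W \<noteq> {}" "open W" "open (poly_disk p - W)" "W \<subseteq> poly_disk p"
    using \<open>V \<noteq> poly_disk p\<close> assms by (auto simp: W_def double_diff)
  have "d - 2 * r ^ 3 \<in> poly p ` V" "d - 2 * r ^ 3 \<in> poly p ` W"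
    using poly_clopen_part_of_poly_disk_surj[OF degree_p] assms W critical by auto
  then obtain v w where vw: "v \<in> V" "w \<in> W" "v = r \<or> v = - 2 * r" "w = r \<or> w = - 2 * r"
    using poly_p_fibre_minus by (metis imageE)
  have "r \<in> closed_segment (- 2 * r) (2 * r)"
    by (auto simp: closed_segment_def scaleR_conv_of_real algebra_simps intro!: exI[of _ "3/4"])
  then have "v \<in> closed_segment (- 2 * r) (2 * r)" "w \<in> closed_segment (- 2 * r) (2 * r)"
    using vw by auto
  then show False
    using connectedD[OF connected_segment \<open>open V\<close> \<open>open W\<close>, of "- 2 * r" "2 * r"]
      segment_subset_poly_disk vw by (auto simp: W_def)
qed

text \<open>Dividing \<open>poly p v - poly p w\<close> by \<open>v - w\<close> leaves a quadratic
  in \<open>v\<close> with discriminant \<open>12 * r\<^sup>2 - 3 * w\<^sup>2\<close>. The excluded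
  points are those where \<open>w\<close> is itself a root of it (\<open>r\<close>,
  \<open>- r\<close>) or where its two roots coincide (\<open>2 * r\<close>,
  \<open>- 2 * r\<close>).\<close>

lemma poly_p_generic_fibre:
  assumes "w \<notin> {r, - r, 2 * r, - 2 * r}"
  obtains v1 v2 where "poly p v1 = poly p w" "poly p v2 = poly p w" "v1 \<noteq> w" "v2 \<noteq> w" "v1 \<noteq> v2"
proof -
  define s where "s = csqrt (12 * r\<^sup>2 - 3 * w\<^sup>2)"
  have s2: "s\<^sup>2 = 12 * r\<^sup>2 - 3 * w\<^sup>2" by (simp add: s_def)
  have sq: "(2 * v + w)\<^sup>2 = s\<^sup>2" if "v = (- w + s) / 2 \<or> v = (- w - s) / 2" for v
    using that
  proof
    assume v: "v = (- w + s) / 2"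
    have "2 * v + w = s" unfolding v by (simp add: field_simps)
    then show ?thesis by simp
  next
    assume v: "v = (- w - s) / 2"
    have "2 * v + w = - s" unfolding v by (simp add: field_simps)
    then show ?thesis by simp
  qed
  have fibre: "poly p v = poly p w" if "v = (- w + s) / 2 \<or> v = (- w - s) / 2" for v
  proof -
    have "(2 * v + w)\<^sup>2 = s\<^sup>2" by (rule sq[OF that])
    then have "4 * (v\<^sup>2 + v * w + w\<^sup>2) = 4 * (3 * r\<^sup>2)"
      unfolding s2 by (simp add: power2_eq_square algebra_simps)
    then have "v\<^sup>2 + v * w + w\<^sup>2 = 3 * r\<^sup>2" by (simp only: mult_cancel_left) simp
    moreover have "poly p v - poly p w = (v - w) * (v\<^sup>2 + v * w + w\<^sup>2 - 3 * r\<^sup>2)"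
      unfolding poly_p by (simp add: power2_eq_square power3_eq_cube algebra_simps)
    ultimately show ?thesis by simp
  qed
  have ne: "v \<noteq> w" if "v = (- w + s) / 2 \<or> v = (- w - s) / 2" for v
  proof
    assume "v = w"
    then have "(3 * w)\<^sup>2 = s\<^sup>2" using sq[OF that] by simp
    then have "w\<^sup>2 = r\<^sup>2" unfolding s2 by (simp add: power2_eq_square)
    then show False using assms by (auto simp: power2_eq_iff)
  qed
  have "s \<noteq> 0"
  proof
    assume "s = 0"
    then have "w\<^sup>2 = (2 * r)\<^sup>2" using s2 by (simp add: power2_eq_square)
    then have "w = 2 * r \<or> w = - (2 * r)" by (simp only: power2_eq_iff)
    then show False using assms by auto
  qed
  then have "(- w + s) / 2 \<noteq> (- w - s) / 2" by simp
  then show ?thesis using that fibre ne by blast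
qed

end

section \<open>Bijectivity of holomorphic lifts through the cubic\<close>

text \<open>Of the Blaschke product only properness and the size of the fibres are retained. The
  lift \<open>\<phi>\<close> is arbitrary, so the results serve both for existence of the model and
  for uniqueness.\<close>

locale cubic_lift = Chebyshev_cubic +
  fixes B \<phi> :: "complex \<Rightarrow> complex"
  assumes B_cont: "continuous_on (cball 0 1) B"
    and B_circle: "\<And>z. norm z = 1 \<Longrightarrow> norm (B z) = 1"
    and B_disk: "\<And>z. norm z < 1 \<Longrightarrow> norm (B z) < 1"
    and finite_fibre: "\<And>k. norm k < 1 \<Longrightarrow> finite {z. norm z < 1 \<and> B z = k}"
    and card_fibre: "\<And>k. norm k < 1 \<Longrightarrow> card {z. norm z < 1 \<and> B z = k} \<le> 3"
    and phi_hol: "\<phi> holomorphic_on unit_disk"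
    and lift: "\<And>z. norm z < 1 \<Longrightarrow> poly p (\<phi> z) = B z"
begin

lemma phi_in_poly_disk: "norm z < 1 \<Longrightarrow> \<phi> z \<in> poly_disk p"
  using lift B_disk by (simp add: poly_disk_def)

lemma open_phi_image:
  assumes "open X" "X \<subseteq> unit_disk"
  shows "open (\<phi> ` X)"
proof (rule open_mapping_thm[OF phi_hol _ _ assms])
  show "\<not> \<phi> constant_on unit_disk"
  proof
    assume "\<phi> constant_on unit_disk"
    then obtain c where c: "\<And>z. norm z < 1 \<Longrightarrow> \<phi> z = c" by (auto simp: constant_on_def)
    then have "unit_disk \<subseteq> {z. norm z < 1 \<and> B z = poly p c}" using lift by auto
    moreover have "norm (poly p c) < 1" using phi_in_poly_disk[of 0] c[of 0] by (simp add: poly_disk_def)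
    ultimately have "finite (unit_disk :: complex set)" using finite_fibre finite_subset by blast
    then show False using finite_imp_not_open[of unit_disk] by auto
  qed
qed auto

text \<open>The image is open by the open mapping theorem, and it is closed in
  \<open>poly_disk p\<close> because \<open>B\<close> is proper as a map of the disk to
  itself.\<close>

lemma phi_image: "\<phi> ` unit_disk = poly_disk p"
proof (rule clopen_part_of_poly_disk)
  show "open (\<phi> ` unit_disk)" by (rule open_phi_image) auto
  show "\<phi> ` unit_disk \<subseteq> poly_disk p" using phi_in_poly_disk by auto
  show "open (poly_disk p - \<phi> ` unit_disk)"
  proof (subst open_subopen, intro ballI)
    fix w assume w: "w \<in> poly_disk p - \<phi> ` unit_disk"
    define \<rho> where "\<rho> = (1 + norm (poly p w)) / 2"
    have \<rho>: "norm (poly p w) < \<rho>" "\<rho> < 1" using w by (auto simp: \<rho>_def poly_disk_def)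
    \<comment> \<open>Every preimage under \<open>\<phi>\<close> of a point where |p| < \<rho> lies
      in \<open>K\<close>. Since |B| = 1 on the circle, \<open>K\<close> is a compact subset of the
      open disk, and removing its compact image leaves a neighbourhood of \<open>w\<close>.\<close>
    define K where "K = {z \<in> cball 0 1. B z \<in> cball 0 \<rho>}"
    have K_disk: "K \<subseteq> unit_disk"
    proof
      fix z assume "z \<in> K"
      then have "norm z \<le> 1" "norm (B z) \<noteq> 1" using \<rho> by (auto simp: K_def)
      then show "z \<in> unit_disk" using B_circle[of z] by (cases "norm z = 1") auto
    qed
    have "K = cball 0 1 \<inter> B -` cball 0 \<rho>" by (auto simp: K_def)
    then have "closed K" by (simp only: continuous_closed_preimage[OF B_cont] closed_cball)
    then have "compact K"
      by (metis (no_types, lifting) K_def bounded_cball bounded_subset compact_eq_bounded_closed mem_Collect_eq subsetI)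
    then have closed: "closed (\<phi> ` K)"
      using K_disk holomorphic_on_imp_continuous_on[OF phi_hol]
      by (intro compact_imp_closed compact_continuous_image) (auto intro: continuous_on_subset)
    let ?T = "poly p -` ball 0 \<rho> - \<phi> ` K"
    have "open ?T" using closed by (intro open_Diff open_vimage continuous_on_poly) auto
    moreover have "w \<in> ?T" using w \<rho> K_disk by auto
    moreover have "?T \<subseteq> poly_disk p - \<phi> ` unit_disk"
    proof
      fix v assume v: "v \<in> ?T"
      have "z \<in> K" if "norm z < 1" "\<phi> z = v" for z
        using v lift[OF that(1)] that by (auto simp: K_def)
      with v show "v \<in> poly_disk p - \<phi> ` unit_disk" using \<rho> by (auto simp: poly_disk_def)
    qed
    ultimately show "\<exists>T. open T \<and> w \<in> T \<and> T \<subseteq> poly_disk p - \<phi> ` unit_disk" by blast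
  qed
qed simp

text \<open>If two points share a value, then by openness a whole open set of values is taken twice,
  and a generic one can be chosen. The other two points of its fibre under \<open>p\<close> are also
  attained, which gives \<open>B\<close> a fibre of four points.\<close>

lemma phi_inj: "inj_on \<phi> unit_disk"
proof (rule inj_onI, rule ccontr)
  fix x y assume xy: "x \<in> unit_disk" "y \<in> unit_disk" "\<phi> x = \<phi> y" "x \<noteq> y"
  then obtain X Y where XY: "open X" "open Y" "x \<in> X" "y \<in> Y" "X \<inter> Y = {}" by (meson hausdorff)
  define W where "W = \<phi> ` (X \<inter> unit_disk) \<inter> \<phi> ` (Y \<inter> unit_disk)"
  have "open W" unfolding W_def by (intro open_Int open_phi_image XY) auto
  moreover have "\<phi> x \<in> W" unfolding W_def using xy XY by blast
  ultimately have "infinite W" using finite_imp_not_open by blast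
  then obtain w where w: "w \<in> W" "w \<notin> {r, - r, 2 * r, - 2 * r}"
    by (metis finite.emptyI finite_insert finite_subset subsetI)
  obtain v1 v2 where v: "poly p v1 = poly p w" "poly p v2 = poly p w" "v1 \<noteq> w" "v2 \<noteq> w" "v1 \<noteq> v2"
    using poly_p_generic_fibre[OF w(2)] .
  obtain x' y' where x': "x' \<in> X \<inter> unit_disk" "\<phi> x' = w" and y': "y' \<in> Y \<inter> unit_disk" "\<phi> y' = w"
    using w(1) by (auto simp: W_def)
  have k: "norm (poly p w) < 1" using phi_in_poly_disk[of x'] x' by (simp add: poly_disk_def)
  then have "v1 \<in> \<phi> ` unit_disk" "v2 \<in> \<phi> ` unit_disk"
    unfolding phi_image using v by (simp_all add: poly_disk_def)
  then obtain x1 x2 where x12: "x1 \<in> unit_disk" "\<phi> x1 = v1" "x2 \<in> unit_disk" "\<phi> x2 = v2" by auto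
  have "{x', y', x1, x2} \<subseteq> {z. norm z < 1 \<and> B z = poly p w}"
    using x' y' x12 lift v by (auto simp flip: lift)
  then have "card {x', y', x1, x2} \<le> card {z. norm z < 1 \<and> B z = poly p w}"
    by (rule card_mono[OF finite_fibre[OF k]])
  also have "\<dots> \<le> 3" by (rule card_fibre[OF k])
  finally have "card {x', y', x1, x2} \<le> 3" .
  moreover have "x' \<noteq> y'" using x'(1) y'(1) XY(5) by blast
  moreover have "x' \<noteq> x1" "x' \<noteq> x2" "y' \<noteq> x1" "y' \<noteq> x2" "x1 \<noteq> x2"
    using x'(2) y'(2) x12 v by metis+
  then have "card {x', y', x1, x2} = 4" using \<open>x' \<noteq> y'\<close> by simp
  ultimately show False by simp
qed

lemma connected_poly_disk: "connected (poly_disk p)"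
  unfolding phi_image[symmetric]
  by (intro connected_continuous_image holomorphic_on_imp_continuous_on phi_hol) auto

end

section \<open>Existence of the lift for a Blaschke product\<close>

text \<open>At a critical point in the disk the cubic numerator of B minus its critical value has a
  double root, leaving one more root, \<open>a\<close> or \<open>b\<close>. With \<open>e\<close>
  half the difference of the critical values, F^2 - 1 is the product of these two numerators over a
  square, as \<open>Chebyshev_lift\<close> requires.\<close>

lemma Blaschke_cubic_lift_exists:
  fixes z1 z2 r d :: complex
  assumes "blaschke_product 3 B"
    and z: "norm z1 < 1" "norm z2 < 1" "deriv B z1 = 0" "deriv B z2 = 0" "z1 \<noteq> z2"
    and r: "4 * r ^ 3 = B z2 - B z1" and d: "2 * d = B z1 + B z2"
  obtains \<phi> where "r \<noteq> 0" "\<phi> holomorphic_on unit_disk"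
    "\<And>z. norm z < 1 \<Longrightarrow> \<phi> z ^ 3 - 3 * r\<^sup>2 * \<phi> z + d = B z"
proof -
  obtain N D R where R: "1 < R" and B: "\<And>z. B z = poly N z / poly D z"
    and D: "\<And>z. norm z < R \<Longrightarrow> poly D z \<noteq> 0"
    and disk: "\<And>z. norm z < 1 \<Longrightarrow> norm (B z) < 1"
    and circle: "\<And>z. norm z = 1 \<Longrightarrow> norm (B z) = 1"
    and root: "\<And>k z. norm k < 1 \<Longrightarrow> poly (N - smult k D) z = 0 \<Longrightarrow> norm z < 1 \<and> B z = k"
    and degree: "\<And>k. norm k < 1 \<Longrightarrow> degree (N - smult k D) = 3"
    using Blaschke_product_rational[OF assms(1)] by metis
  have critical: "\<exists>C a. C \<noteq> 0 \<and> N - smult (B z) D = smult C ([:- z, 1:]\<^sup>2 * [:- a, 1:])"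
    if "norm z < 1" "deriv B z = 0" for z
  proof -
    have Dz: "poly D z \<noteq> 0" using D that R by simp
    have "B = (\<lambda>z. poly N z / poly D z)" using B by auto
    then have "(B has_field_derivative
        (poly (pderiv N) z * poly D z - poly N z * poly (pderiv D) z) / (poly D z * poly D z)) (at z)"
      using DERIV_divide[OF poly_DERIV poly_DERIV Dz] by simp
    from DERIV_imp_deriv[OF this] that(2) Dz
    have "poly (pderiv N) z * poly D z = poly N z * poly (pderiv D) z" by simp
    also have "poly N z = B z * poly D z" using B Dz by simp
    finally have "poly (pderiv (N - smult (B z) D)) z = 0"
      using Dz by (simp add: pderiv_diff pderiv_smult)
    moreover have "poly (N - smult (B z) D) z = 0" using B Dz by simp
    ultimately show ?thesis
      using cubic_with_double_root[OF degree[OF disk[OF that(1)]]] by metis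
  qed
  define k1 k2 where "k1 = B z1" and "k2 = B z2"
  obtain C1 a where a: "C1 \<noteq> 0" "N - smult k1 D = smult C1 ([:- z1, 1:]\<^sup>2 * [:- a, 1:])"
    using critical[OF z(1,3)] unfolding k1_def by blast
  obtain C2 b where b: "C2 \<noteq> 0" "N - smult k2 D = smult C2 ([:- z2, 1:]\<^sup>2 * [:- b, 1:])"
    using critical[OF z(2,4)] unfolding k2_def by blast
  have minus: "B z - k1 = C1 * (z - z1)\<^sup>2 * (z - a) / poly D z"
    and plus: "B z - k2 = C2 * (z - z2)\<^sup>2 * (z - b) / poly D z" if "norm z < R" for z
    using arg_cong[OF a(2), of "\<lambda>P. poly P z"] arg_cong[OF b(2), of "\<lambda>P. poly P z"] D[OF that]
    by (simp_all add: B field_simps)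
  have k: "norm k1 < 1" "norm k2 < 1" using disk z by (auto simp: k1_def k2_def)
  have "norm a < 1 \<and> B a = k1" by (rule root[OF k(1)]) (simp add: a)
  moreover have "norm b < 1 \<and> B b = k2" by (rule root[OF k(2)]) (simp add: b)
  ultimately have ab: "norm a < 1" "B a = k1" "norm b < 1" "B b = k2" by auto
  \<comment> \<open>Otherwise a single polynomial of degree three would have double roots at both
    \<open>z1\<close> and \<open>z2\<close>.\<close>
  have "k1 \<noteq> k2"
  proof
    assume eq: "k1 = k2"
    let ?P = "N - smult k1 D"
    have deriv: "poly (pderiv (smult C ([:- x, 1:]\<^sup>2 * [:- y, 1:]))) w
        = C * (2 * (w - x) * (w - y) + (w - x)\<^sup>2)" for C x y w :: complex
      by (simp add: pderiv_smult pderiv_mult power2_eq_square pderiv_pCons algebra_simps)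
    have "poly ?P z2 = 0" "poly (pderiv ?P) z2 = 0" unfolding eq b(2) deriv by simp_all
    then have "C1 * ((z2 - z1)\<^sup>2 * (z2 - a)) = 0" "C1 * (2 * (z2 - z1) * (z2 - a) + (z2 - z1)\<^sup>2) = 0"
      unfolding a(2) deriv by simp_all
    then show False using a(1) z(5) by auto
  qed
  then have r3: "4 * r ^ 3 = k2 - k1" "r \<noteq> 0" using r by (auto simp: k1_def k2_def)
  define e where "e = 2 * r ^ 3"
  have "2 * (d - e) = 2 * k1" "2 * (d + e) = 2 * k2"
    using r3(1) d by (simp_all add: e_def k1_def k2_def algebra_simps)
  then have "d - e = k1" "d + e = k2"
    by (simp_all only: mult_cancel_left) simp_all
  moreover have "e \<noteq> 0" using r3(2) by (simp add: e_def)
  ultimately have e: "e \<noteq> 0" "k1 = d - e" "k2 = d + e" by simp_all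
  have "norm d < 1"
  proof -
    have "2 * norm d = norm (k1 + k2)"
      using arg_cong[OF d, of norm] by (simp add: k1_def k2_def norm_mult)
    also have "\<dots> < 2" using norm_triangle_ineq[of k1 k2] k by linarith
    finally show ?thesis by simp
  qed
  define F where "F = (\<lambda>z. (B z - d) / e)"
  define K where "K = (\<lambda>z. csqrt (C1 * C2) * (z - z1) * (z - z2) / (poly D z * e))"
  obtain q where q: "continuous_on (sphere 0 1) q" "\<And>z. norm z = 1 \<Longrightarrow> B z = z ^ 3 * exp (q z)"
    using Blaschke_product_log_on_circle[OF assms(1)] by blast
  \<comment> \<open>A logarithm of \<open>F z / z ^ 3\<close> on the circle, from F = B (1 - d / B)
    / e. The middle logarithm is continuous because |d| < 1 = |B|.\<close>
  define q' where "q' = (\<lambda>z. q z + Ln (1 - d / B z) - Ln e)"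
  have B_hol: "B holomorphic_on ball 0 R"
  proof -
    have "B = (\<lambda>z. poly N z / poly D z)" using B by auto
    then show ?thesis using D by (auto intro!: holomorphic_intros)
  qed
  have slit: "1 - d / B z \<notin> \<real>\<^sub>\<le>\<^sub>0" if "norm z = 1" for z
  proof -
    have "norm (d / B z) < 1" using \<open>norm d < 1\<close> circle[OF that] by (simp add: norm_divide)
    then show ?thesis using abs_Re_le_cmod[of "d / B z"] by (auto simp: complex_nonpos_Reals_iff)
  qed
  obtain G where G: "G holomorphic_on ball 0 R" "\<And>z. z \<in> ball 0 R \<Longrightarrow> 4 * G z ^ 3 - 3 * G z = F z"
  proof (rule Chebyshev_lift[of R a b F K q'])
    show "a \<noteq> b" using ab \<open>k1 \<noteq> k2\<close> by auto
    show "F holomorphic_on ball 0 R" unfolding F_def using e by (intro holomorphic_intros B_hol) auto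
    show "K holomorphic_on ball 0 R" unfolding K_def using e D by (intro holomorphic_intros) auto
    show "(F z)\<^sup>2 - 1 = (z - a) * (z - b) * (K z)\<^sup>2" if "z \<in> ball 0 R" for z
    proof -
      have "(F z)\<^sup>2 - 1 = (F z + 1) * (F z - 1)" by (simp add: power2_eq_square algebra_simps)
      also have "F z + 1 = (B z - k1) / e" using e by (simp add: F_def field_simps)
      also have "F z - 1 = (B z - k2) / e" using e by (simp add: F_def field_simps)
      also have "(B z - k1) / e * ((B z - k2) / e)
          = (z - a) * (z - b) * ((csqrt (C1 * C2))\<^sup>2 * (z - z1)\<^sup>2 * (z - z2)\<^sup>2 / (poly D z * e)\<^sup>2)"
        unfolding power2_csqrt using minus[of z] plus[of z] that by (simp add: power2_eq_square)
      also have "\<dots> = (z - a) * (z - b) * (K z)\<^sup>2"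
        unfolding K_def power_divide power_mult_distrib by simp
      finally show ?thesis .
    qed
    show "F b = 1" using ab e by (simp add: F_def)
    show "F z = z ^ 3 * exp (q' z)" if "norm z = 1" for z
    proof -
      have "B z \<noteq> 0" "1 - d / B z \<noteq> 0" using circle[OF that] slit[OF that] by auto
      then have "z ^ 3 * exp (q' z) = B z * ((1 - d / B z) / e)"
        using e q(2)[OF that] by (simp add: q'_def exp_add exp_diff)
      also have "\<dots> = F z" using \<open>B z \<noteq> 0\<close> e by (simp add: F_def field_simps)
      finally show ?thesis by simp
    qed
    have "continuous_on (sphere 0 1) B"
      by (rule continuous_on_subset[OF holomorphic_on_imp_continuous_on[OF B_hol]]) (use R in auto)
    then show "continuous_on (sphere 0 1) q'"
      unfolding q'_def using slit circle by (intro continuous_intros q(1)) force+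
    show "F z \<notin> of_real ` {-1..1}" if "norm z = 1" for z
    proof
      assume "F z \<in> of_real ` {-1..1}"
      then obtain x where x: "-1 \<le> x" "x \<le> 1" "B z = d + of_real x * e"
        using e by (auto simp: F_def field_simps)
      have "((1 - x) / 2) *\<^sub>R k1 + ((1 + x) / 2) *\<^sub>R k2 \<in> ball 0 1"
        using x k by (intro convexD[OF convex_ball]) (auto simp: field_simps)
      also have "((1 - x) / 2) *\<^sub>R k1 + ((1 + x) / 2) *\<^sub>R k2 = B z"
        unfolding x(3) e by (simp add: scaleR_conv_of_real field_simps)
      finally show False using circle[OF that] by simp
    qed
  qed (use R ab in auto)
  show ?thesis
  proof (rule that[of "\<lambda>z. 2 * r * G z"])
    have "unit_disk \<subseteq> ball 0 R" using R by auto
    then show "(\<lambda>z. 2 * r * G z) holomorphic_on unit_disk"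
      using G(1) by (intro holomorphic_intros) (rule holomorphic_on_subset)
    fix z :: complex assume "norm z < 1"
    then have "4 * G z ^ 3 - 3 * G z = F z" using R by (intro G(2)) simp
    then have "e * (4 * G z ^ 3 - 3 * G z) + d = B z" using e by (simp add: F_def)
    then show "(2 * r * G z) ^ 3 - 3 * r\<^sup>2 * (2 * r * G z) + d = B z"
      by (simp add: e_def power2_eq_square power3_eq_cube algebra_simps)
  qed (use r3 in auto)
qed

lemma Blaschke_product_fibre:
  assumes "blaschke_product n B" "norm k < 1"
  shows "finite {z. norm z < 1 \<and> B z = k}" "card {z. norm z < 1 \<and> B z = k} \<le> n"
proof -
  obtain N D R where R: "1 < R" and B: "\<And>z. B z = poly N z / poly D z"
    and D: "\<And>z. norm z < R \<Longrightarrow> poly D z \<noteq> 0"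
    and degree: "\<And>k. norm k < 1 \<Longrightarrow> degree (N - smult k D) = n"
    using Blaschke_product_rational[OF assms(1)] by metis
  let ?P = "N - smult k D"
  have "n \<ge> 1" using assms(1) by (simp add: blaschke_product_def)
  then have P: "?P \<noteq> 0" using degree[OF assms(2)] by auto
  have sub: "{z. norm z < 1 \<and> B z = k} \<subseteq> {z. poly ?P z = 0}"
    using B D R by (auto simp: field_simps)
  show "finite {z. norm z < 1 \<and> B z = k}"
    using sub poly_roots_finite[OF P] by (rule finite_subset)
  have "card {z. norm z < 1 \<and> B z = k} \<le> card {z. poly ?P z = 0}"
    using sub poly_roots_finite[OF P] by (intro card_mono)
  also have "\<dots> \<le> n" using card_poly_roots_bound[OF P] degree[OF assms(2)] by simp
  finally show "card {z. norm z < 1 \<and> B z = k} \<le> n" .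
qed

lemma Blaschke_product_analytic:
  assumes "blaschke_product n B"
  shows "B analytic_on cball 0 1"
proof -
  obtain N D R where R: "1 < R" and B: "\<And>z. B z = poly N z / poly D z"
    and D: "\<And>z. norm z < R \<Longrightarrow> poly D z \<noteq> 0"
    using Blaschke_product_rational[OF assms(1)] by metis
  have "B = (\<lambda>z. poly N z / poly D z)" using B by auto
  then have "B holomorphic_on ball 0 R" using D by (auto intro!: holomorphic_intros)
  then have "B analytic_on ball 0 R" by (simp add: analytic_on_open)
  then show ?thesis by (rule analytic_on_subset) (use R in auto)
qed

section \<open>Cardano's formula and the three assertions of the theorem\<close>

text \<open>Cardano's derivation read backwards, starting from the root: \<open>U\<close> and
  \<open>V\<close> are the two solutions of X^2 - w X - c/3 = 0, with \<open>t\<close> a square root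
  of the discriminant, and \<open>S\<close> is half the difference of their cubes. No cube root has
  to be chosen.\<close>

lemma cubic_formula:
  fixes c e w :: complex
  assumes "w ^ 3 + c * w + e = 0"
  shows "\<exists>S U V. S ^ 2 = e ^ 2 / 4 + c ^ 3 / 27 \<and> U ^ 3 = - e / 2 + S \<and>
    V ^ 3 = - e / 2 - S \<and> U * V = - c / 3 \<and> w = U + V"
proof -
  define t where "t = csqrt (w\<^sup>2 + 4 * c / 3)"
  define U V where "U = (w + t) / 2" and "V = (w - t) / 2"
  have t: "t\<^sup>2 = w\<^sup>2 + 4 * c / 3" by (simp add: t_def)
  have w: "w = U + V" by (simp add: U_def V_def field_simps)
  have "U * V = (w\<^sup>2 - t\<^sup>2) / 4" by (simp add: U_def V_def power2_eq_square field_simps)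
  then have UV: "U * V = - c / 3" by (simp add: t)
  have "U ^ 3 + V ^ 3 = w ^ 3 - 3 * (U * V) * w"
    unfolding w by (simp add: power3_eq_cube algebra_simps)
  also have "\<dots> = - e" using assms by (simp add: UV algebra_simps add_eq_0_iff)
  finally have sum: "U ^ 3 + V ^ 3 = - e" .
  define S where "S = (U ^ 3 - V ^ 3) / 2"
  have "(U ^ 3 - V ^ 3)\<^sup>2 = (U ^ 3 + V ^ 3)\<^sup>2 - 4 * (U * V) ^ 3"
    by (simp add: power2_eq_square power_mult_distrib algebra_simps)
  then have "S\<^sup>2 = e\<^sup>2 / 4 + c ^ 3 / 27"
    by (simp add: S_def power_divide sum UV)
  moreover have "U ^ 3 = (U ^ 3 + V ^ 3) / 2 + S" "V ^ 3 = (U ^ 3 + V ^ 3) / 2 - S"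
    by (simp_all add: S_def field_simps)
  ultimately show ?thesis using UV w unfolding sum by blast
qed

theorem mainTheorem1:
  fixes B :: "complex \<Rightarrow> complex" and z1 z2 k1 k2 r c d :: complex and p :: "complex poly"
  assumes "blaschke_product 3 B"
    and "z1 \<in> critical_points B unit_disk" and "z2 \<in> critical_points B unit_disk"
    and "z1 \<noteq> z2"
    and "k1 = B z1" and "k2 = B z2"
    and "r ^ 3 = (k2 - k1) / 4"
    and "c = - 3 * r ^ 2" and "d = (k1 + k2) / 2"
    and "p = [:d, c, 0, 1:]"
  shows "(critical_values (poly p) UNIV = {k1, k2} \<and>
      conformal_model (poly p) (poly_disk p) B unit_disk) \<and>
    (\<forall>\<phi>. conformal_equivalence \<phi> B unit_disk (poly p) (poly_disk p) \<longrightarrow>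
      (\<forall>z\<in>unit_disk. \<exists>S U V.
         S ^ 2 = (d - B z) ^ 2 / 4 + c ^ 3 / 27 \<and>
         U ^ 3 = - (d - B z) / 2 + S \<and>
         V ^ 3 = - (d - B z) / 2 - S \<and>
         U * V = - c / 3 \<and>
         \<phi> z = U + V)) \<and>
    (\<forall>\<phi> \<psi>.
      \<phi> analytic_on unit_disk \<and> (\<forall>z\<in>unit_disk. \<phi> z ^ 3 + c * \<phi> z + (d - B z) = 0) \<and>
      \<psi> analytic_on unit_disk \<and> (\<forall>z\<in>unit_disk. \<psi> z ^ 3 + c * \<psi> z + (d - B z) = 0) \<longrightarrow>
      (\<forall>z\<in>unit_disk. \<phi> z = \<psi> z))"
proof -
  have z: "norm z1 < 1" "norm z2 < 1" "deriv B z1 = 0" "deriv B z2 = 0"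
    using assms(2,3) by (auto simp: critical_points_def)
  have r4: "4 * r ^ 3 = B z2 - B z1" and d2: "2 * d = B z1 + B z2"
    using assms(5-7,9) by (simp_all add: mult.commute)
  obtain \<phi>0 where "r \<noteq> 0" and hol0: "\<phi>0 holomorphic_on unit_disk"
    and lift0: "\<And>z. norm z < 1 \<Longrightarrow> \<phi>0 z ^ 3 - 3 * r\<^sup>2 * \<phi>0 z + d = B z"
    using Blaschke_cubic_lift_exists[OF assms(1) z assms(4) r4 d2] by blast
  have "2 * (d - 2 * r ^ 3) = 2 * k1" "2 * (d + 2 * r ^ 3) = 2 * k2"
    using r4 d2 assms(5,6) by (simp_all add: algebra_simps)
  then have k: "d - 2 * r ^ 3 = k1" "d + 2 * r ^ 3 = k2"
    by (simp_all only: mult_cancel_left) simp_all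
  have B_disk: "norm (B z) < 1" if "norm z < 1" for z
    using Blaschke_product_rational[OF assms(1)] that by metis
  have B_circle: "norm (B z) = 1" if "norm z = 1" for z
    using Blaschke_product_rational[OF assms(1)] that by metis
  have k_disk: "norm k1 < 1" "norm k2 < 1"
    using B_disk z assms(5,6) by auto
  interpret Chebyshev_cubic r d p
    using \<open>r \<noteq> 0\<close> k k_disk assms(8,10) by unfold_locales simp_all
  have B_analytic: "B analytic_on cball 0 1" by (rule Blaschke_product_analytic[OF assms(1)])
  have is_lift: "cubic_lift r d p B \<phi>"
    if "\<phi> analytic_on unit_disk" "\<And>z. norm z < 1 \<Longrightarrow> poly p (\<phi> z) = B z" for \<phi>
  proof unfold_locales
    show "continuous_on (cball 0 1) B"
      by (intro holomorphic_on_imp_continuous_on analytic_imp_holomorphic B_analytic)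
    show "\<phi> holomorphic_on unit_disk" using that(1) by (rule analytic_imp_holomorphic)
  qed (use B_disk B_circle Blaschke_product_fibre[OF assms(1)] that(2) in auto)
  have equation: "w ^ 3 + c * w + (d - v) = 0 \<longleftrightarrow> poly p w = v" for v w
    unfolding poly_p assms(8) by (auto simp: algebra_simps)
  have deriv_p: "deriv (poly p) w = 3 * (w\<^sup>2 - r\<^sup>2)" for w
  proof -
    have "deriv (poly p) w = poly (pderiv p) w" by (rule DERIV_imp_deriv[OF poly_DERIV])
    also have "\<dots> = 3 * (w\<^sup>2 - r\<^sup>2)" by (simp add: p_def pderiv_pCons power2_eq_square algebra_simps)
    finally show ?thesis .
  qed
  have critical_p: "deriv (poly p) w = 0 \<longleftrightarrow> w = r \<or> w = - r" for w
    by (simp add: deriv_p power2_eq_iff)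
  have p_values: "poly p r = k1" "poly p (- r) = k2" "poly p (- 2 * r) = k1"
    unfolding k[symmetric] poly_p by (simp_all add: power2_eq_square power3_eq_cube algebra_simps)
  have "critical_points (poly p) UNIV = {r, - r}"
    using critical_p by (auto simp: critical_points_def)
  then have critical_values: "critical_values (poly p) UNIV = {k1, k2}"
    by (simp add: critical_values_def p_values)
  have model: "conformal_model (poly p) (poly_disk p) B unit_disk"
  proof -
    have an: "\<phi>0 analytic_on unit_disk" using hol0 by (simp add: analytic_on_open)
    have "poly p (\<phi>0 z) = B z" if "norm z < 1" for z using lift0[OF that] by (simp add: poly_p)
    then interpret cubic_lift r d p B \<phi>0 using an by (intro is_lift)
    have "conformal_equivalence \<phi>0 B unit_disk (poly p) (poly_disk p)"
      using an phi_inj phi_image lift by (auto simp: conformal_equivalence_def bij_betw_def)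
    moreover have "B analytic_on unit_disk" using B_analytic by (rule analytic_on_subset) auto
    moreover have "poly p analytic_on poly_disk p"
      by (rule analytic_on_subset[of _ UNIV]) (auto simp: analytic_on_open intro: holomorphic_intros)
    ultimately show ?thesis
      unfolding conformal_model_def using open_poly_disk connected_poly_disk by auto
  qed
  have formula: "\<exists>S U V. S ^ 2 = (d - B z) ^ 2 / 4 + c ^ 3 / 27 \<and> U ^ 3 = - (d - B z) / 2 + S \<and>
      V ^ 3 = - (d - B z) / 2 - S \<and> U * V = - c / 3 \<and> \<phi> z = U + V"
    if "conformal_equivalence \<phi> B unit_disk (poly p) (poly_disk p)" "z \<in> unit_disk" for \<phi> z
    using that by (intro cubic_formula) (simp add: equation conformal_equivalence_def)
  \<comment> \<open>Injectivity makes the derivative of \<open>\<phi>\<close> nonzero, so the chain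
    rule sends \<open>z1\<close> to a critical point of \<open>p\<close>. Of \<open>r\<close> and
    \<open>- r\<close> only \<open>r\<close> lies over \<open>k1\<close>.\<close>
  have at_z1: "\<phi> z1 = r"
    if "\<phi> analytic_on unit_disk" "\<And>z. norm z < 1 \<Longrightarrow> poly p (\<phi> z) = B z" for \<phi>
  proof -
    interpret cubic_lift r d p B \<phi> using that by (rule is_lift)
    have z1: "z1 \<in> unit_disk" using z by simp
    have "(\<phi> has_field_derivative deriv \<phi> z1) (at z1)"
      using phi_hol z1 by (intro holomorphic_derivI) auto
    moreover have "(poly p has_field_derivative deriv (poly p) (\<phi> z1)) (at (\<phi> z1))"
      using poly_DERIV DERIV_imp_deriv by metis
    ultimately have "(poly p \<circ> \<phi> has_field_derivative deriv (poly p) (\<phi> z1) * deriv \<phi> z1) (at z1)"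
      by (intro DERIV_chain)
    then have "(B has_field_derivative deriv (poly p) (\<phi> z1) * deriv \<phi> z1) (at z1)"
      by (rule has_field_derivative_transform_within_open[of _ _ _ unit_disk]) (use z1 lift in auto)
    then have "deriv (poly p) (\<phi> z1) * deriv \<phi> z1 = 0" using z(3) DERIV_imp_deriv by metis
    moreover have "deriv \<phi> z1 \<noteq> 0"
      using holomorphic_injective_imp_regular[OF phi_hol _ phi_inj z1] by simp
    ultimately have "\<phi> z1 = r \<or> \<phi> z1 = - r" using critical_p by auto
    moreover have "poly p (\<phi> z1) = d - 2 * r ^ 3" using lift z assms(5) k(1) by simp
    then have "\<phi> z1 = r \<or> \<phi> z1 = - 2 * r" by (simp only: poly_p_fibre_minus)
    ultimately show ?thesis using \<open>r \<noteq> 0\<close> by auto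
  qed
  have unique: "\<phi> z = \<psi> z"
    if \<phi>: "\<phi> analytic_on unit_disk" "\<And>z. norm z < 1 \<Longrightarrow> poly p (\<phi> z) = B z"
      and \<psi>: "\<psi> analytic_on unit_disk" "\<And>z. norm z < 1 \<Longrightarrow> poly p (\<psi> z) = B z"
      and "norm z < 1" for \<phi> \<psi> z
  proof -
    interpret \<phi>: cubic_lift r d p B \<phi> using \<phi> by (rule is_lift)
    interpret \<psi>: cubic_lift r d p B \<psi> using \<psi> by (rule is_lift)
    have "- 2 * r \<in> poly_disk p" using p_values k_disk by (simp add: poly_disk_def)
    then obtain x where x: "x \<in> unit_disk" "\<phi> x = - 2 * r" using \<phi>.phi_image by (metis imageE)
    have ne: "r \<noteq> - 2 * r" using \<open>r \<noteq> 0\<close> by (simp add: eq_neg_iff_add_eq_0)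
    \<comment> \<open>The injective \<open>\<psi>\<close> takes the value \<open>r\<close> only at
      \<open>z1\<close>, where \<open>\<phi>\<close> equals \<open>r\<close> and not
      \<open>- 2 * r\<close>.\<close>
    have "\<psi> x \<noteq> r"
    proof
      assume "\<psi> x = r"
      then have "x = z1"
        using inj_onD[OF \<psi>.phi_inj, of x z1] at_z1[OF \<psi>] x(1) z by simp
      then show False using x(2) at_z1[OF \<phi>] ne by simp
    qed
    moreover have "poly p (\<psi> x) = d - 2 * r ^ 3" using \<psi>.lift \<phi>.lift x p_values k by force
    ultimately have \<psi>x: "\<psi> x = - 2 * r" using poly_p_fibre_minus by blast
    \<comment> \<open>The cofactor of \<open>\<phi> z - \<psi> z\<close> in
      \<open>poly p (\<phi> z) - poly p (\<psi> z)\<close>. At \<open>x\<close> it equals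
      \<open>9 * r\<^sup>2\<close>, so it is nonzero nearby and the two lifts coincide
      there.\<close>
    define T where "T = (\<lambda>z. \<phi> z ^ 2 + \<phi> z * \<psi> z + \<psi> z ^ 2 - 3 * r\<^sup>2)"
    have cont_T: "continuous_on unit_disk T"
      unfolding T_def by (intro continuous_intros holomorphic_on_imp_continuous_on \<phi>.phi_hol \<psi>.phi_hol)
    have "T x \<noteq> 0" unfolding T_def x(2) \<psi>x using \<open>r \<noteq> 0\<close> by (simp add: power2_eq_square)
    define A where "A = T -` (- {0}) \<inter> unit_disk"
    have "open A"
      unfolding A_def using cont_T by (subst (asm) continuous_on_open_vimage) auto
    have "x \<in> A" using x \<open>T x \<noteq> 0\<close> by (simp add: A_def)
    have "\<phi> v = \<psi> v" if "v \<in> A" for v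
    proof -
      have "(\<phi> v - \<psi> v) * T v = poly p (\<phi> v) - poly p (\<psi> v)"
        unfolding T_def poly_p by (simp add: power2_eq_square power3_eq_cube algebra_simps)
      also have "\<dots> = 0" using that \<phi>.lift \<psi>.lift by (simp add: A_def)
      finally show ?thesis using that by (simp add: A_def)
    qed
    moreover have "A \<noteq> {}" "A \<subseteq> unit_disk" using \<open>x \<in> A\<close> by (auto simp: A_def)
    ultimately show ?thesis
      using analytic_continuation_open[of A unit_disk \<phi> \<psi> z] \<open>open A\<close>
        \<phi>.phi_hol \<psi>.phi_hol \<open>norm z < 1\<close> by simp
  qed
  show ?thesis
    using critical_values model formula unique unfolding equation by simp
qed

end
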